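(* Let $T$ be a non-radial tree and let $M$ be a maximum split-set of $T$. Then $i_{\operatorname{bn}}(T)\leq\gamma_{b}(T)+\left\lceil \frac{|M|+1}{3}\right\rceil$.
   Context: All graphs are finite, simple, connected. A broadcast on a connected graph $G=(V,E)$ is a function $f:V\to\{0,1,\dots,\operatorname{diam}(G)\}$ with $f(v)\le e(v)$ (the eccentricity of $v$) for all $v$ if $|V|\ge 2$, and $f(v)=1$ if $V=\{v\}$. Its cost is $\sigma(f)=\sum_{v\in V}f(v)$, and $V_f^+=\{v:f(v)>0\}$. A vertex $u$ hears $f$ from $v\in V_f^+$ if $d(u,v)\le f(v)$; $f$ is dominating if every vertex hears $f$ from some vertex of $V_f^+$. The broadcast number $\gamma_b(G)$ is the minimum cost of a dominating broadcast; a tree $T$ is radial if $\gamma_b(T)=\operatorname{rad}(T)$. A broadcast $f$ is bn-independent if every vertex $x$ that hears $f$ from more than one vertex of $V_f^+$ satisfies $d(x,u)\ge f(u)$ for all $u\in V_f^+$. It is maximal bn-independent if it is bn-independent and there is no bn-independent broadcast $g\ne f$ with $g(v)\ge f(v)$ for all $v$. $i_{\operatorname{bn}}(G)$ is the minimum cost of a maximal bn-independent broadcast on $G$. Split-sets: let $T$ be a tree with diametrical path $P$ (a path of length $\operatorname{diam}(T)$) and $M\subseteq E(P)$ with $|M|=m\ge1$; let $T_1,\dots,T_{m+1}$ be the components of $T-M$ and $P_i$ the subpath of $P$ in $T_i$. $M$ is a split-set of $T$ if each $P_i$ has even, positive length and is a diametrical path of $T_i$; a maximum split-set is a split-set of maximum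 cardinality. *)

theory Defs
  imports Complex_Main "HOL-Library.FuncSet"
begin

section \<open>Finite simple graphs\<close>

datatype 'a graph = Graph (verts: "'a set") (edges: "'a set set")

definition simple_graph :: "'a graph \<Rightarrow> bool" where
  "simple_graph G \<longleftrightarrow>
     finite (verts G) \<and> (\<forall>e \<in> edges G. \<exists>u \<in> verts G. \<exists>v \<in> verts G. u \<noteq> v \<and> e = {u, v})"

definition walk :: "'a graph \<Rightarrow> 'a list \<Rightarrow> bool" where
  "walk G xs \<longleftrightarrow>
     xs \<noteq> [] \<and> set xs \<subseteq> verts G \<and> successively (\<lambda>u v. {u, v} \<in> edges G) xs"

definition graph_path :: "'a graph \<Rightarrow> 'a list \<Rightarrow> bool" where
  "graph_path G xs \<longleftrightarrow> walk G xs \<and> distinct xs"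

text \<open>Walks and paths are nonempty vertex lists; their length is the number of edges.\<close>

definition walk_length :: "'a list \<Rightarrow> nat" where
  "walk_length xs = length xs - 1"

definition walk_edges :: "'a list \<Rightarrow> 'a set set" where
  "walk_edges xs = {{xs ! i, xs ! Suc i} | i. Suc i < length xs}"

definition reachable :: "'a graph \<Rightarrow> 'a \<Rightarrow> 'a \<Rightarrow> bool" where
  "reachable G u v \<longleftrightarrow> (\<exists>xs. walk G xs \<and> hd xs = u \<and> last xs = v)"

definition connected_graph :: "'a graph \<Rightarrow> bool" where
  "connected_graph G \<longleftrightarrow>
     simple_graph G \<and> verts G \<noteq> {} \<and> (\<forall>u \<in> verts G. \<forall>v \<in> verts G. reachable G u v)"

definition graph_cycle :: "'a graph \<Rightarrow> 'a list \<Rightarrow> bool" where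
  "graph_cycle G xs \<longleftrightarrow> graph_path G xs \<and> 3 \<le> length xs \<and> {last xs, hd xs} \<in> edges G"

definition tree :: "'a graph \<Rightarrow> bool" where
  "tree G \<longleftrightarrow> connected_graph G \<and> \<not> (\<exists>xs. graph_cycle G xs)"

text \<open>The following metric notions are meaningful for connected graphs only.\<close>

definition gdist :: "'a graph \<Rightarrow> 'a \<Rightarrow> 'a \<Rightarrow> nat" where
  "gdist G u v = (LEAST n. \<exists>xs. walk G xs \<and> hd xs = u \<and> last xs = v \<and> walk_length xs = n)"

definition ecc :: "'a graph \<Rightarrow> 'a \<Rightarrow> nat" where
  "ecc G v = Max (gdist G v ` verts G)"

definition diam :: "'a graph \<Rightarrow> nat" where
  "diam G = Max (ecc G ` verts G)"

definition rad :: "'a graph \<Rightarrow> nat" where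
  "rad G = Min (ecc G ` verts G)"

definition delete_edges :: "'a graph \<Rightarrow> 'a set set \<Rightarrow> 'a graph" where
  "delete_edges G M = Graph (verts G) (edges G - M)"

definition induced_subgraph :: "'a graph \<Rightarrow> 'a set \<Rightarrow> 'a graph" where
  "induced_subgraph G U = Graph U {e \<in> edges G. e \<subseteq> U}"

definition components :: "'a graph \<Rightarrow> 'a graph set" where
  "components G = (\<lambda>v. induced_subgraph G {u. reachable G v u}) ` verts G"


section \<open>Broadcasts\<close>

text \<open>Broadcasts are extensional functions, so that equality of broadcasts is equality on the
  vertex set. On a one-vertex graph the only broadcast has the value 1, although the diameter
  is 0.\<close>

definition broadcast :: "'a graph \<Rightarrow> ('a \<Rightarrow> nat) \<Rightarrow> bool" where
  "broadcast G f \<longleftrightarrow>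
     (if card (verts G) = 1 then f \<in> verts G \<rightarrow>\<^sub>E {1}
      else f \<in> verts G \<rightarrow>\<^sub>E {0..diam G} \<and> (\<forall>v \<in> verts G. f v \<le> ecc G v))"

definition cost :: "'a graph \<Rightarrow> ('a \<Rightarrow> nat) \<Rightarrow> nat" where
  "cost G f = (\<Sum>v \<in> verts G. f v)"

definition broadcasters :: "'a graph \<Rightarrow> ('a \<Rightarrow> nat) \<Rightarrow> 'a set" where
  "broadcasters G f = {v \<in> verts G. f v > 0}"

definition hears :: "'a graph \<Rightarrow> ('a \<Rightarrow> nat) \<Rightarrow> 'a \<Rightarrow> 'a \<Rightarrow> bool" where
  "hears G f u v \<longleftrightarrow> v \<in> broadcasters G f \<and> gdist G u v \<le> f v"

definition dominating_broadcast :: "'a graph \<Rightarrow> ('a \<Rightarrow> nat) \<Rightarrow> bool" where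
  "dominating_broadcast G f \<longleftrightarrow> broadcast G f \<and> (\<forall>u \<in> verts G. \<exists>v. hears G f u v)"

definition broadcast_number :: "'a graph \<Rightarrow> nat" where
  "broadcast_number G = (LEAST n. \<exists>f. dominating_broadcast G f \<and> cost G f = n)"

definition radial :: "'a graph \<Rightarrow> bool" where
  "radial G \<longleftrightarrow> broadcast_number G = rad G"

definition bn_independent :: "'a graph \<Rightarrow> ('a \<Rightarrow> nat) \<Rightarrow> bool" where
  "bn_independent G f \<longleftrightarrow> broadcast G f \<and>
     (\<forall>x \<in> verts G. (\<exists>v w. v \<noteq> w \<and> hears G f x v \<and> hears G f x w) \<longrightarrow>
        (\<forall>u \<in> broadcasters G f. f u \<le> gdist G x u))"

definition maximal_bn_independent :: "'a graph \<Rightarrow> ('a \<Rightarrow> nat) \<Rightarrow> bool" where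
  "maximal_bn_independent G f \<longleftrightarrow> bn_independent G f \<and>
     \<not> (\<exists>g. bn_independent G g \<and> g \<noteq> f \<and> (\<forall>v \<in> verts G. f v \<le> g v))"

definition i_bn :: "'a graph \<Rightarrow> nat" where
  "i_bn G = (LEAST n. \<exists>f. maximal_bn_independent G f \<and> cost G f = n)"


section \<open>Split-sets\<close>

definition diametrical_path :: "'a graph \<Rightarrow> 'a list \<Rightarrow> bool" where
  "diametrical_path G xs \<longleftrightarrow> graph_path G xs \<and> walk_length xs = diam G"

text \<open>For a path \<open>P\<close> of a tree and a component \<open>H\<close> left after deleting edges of \<open>P\<close>, the vertices
  of \<open>P\<close> lying in \<open>H\<close> are consecutive on \<open>P\<close>, so listing them in order gives the subpath of \<open>P\<close>
  in \<open>H\<close>.\<close>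

definition subpath_in :: "'a list \<Rightarrow> 'a graph \<Rightarrow> 'a list" where
  "subpath_in P H = filter (\<lambda>v. v \<in> verts H) P"

text \<open>The diametrical path is not part of the data: it may differ from one split-set of the tree
  to another.\<close>

definition split_set :: "'a graph \<Rightarrow> 'a set set \<Rightarrow> bool" where
  "split_set T M \<longleftrightarrow>
     (\<exists>P. diametrical_path T P \<and> M \<subseteq> walk_edges P \<and> 1 \<le> card M \<and>
        (\<forall>H \<in> components (delete_edges T M).
           even (walk_length (subpath_in P H)) \<and> 0 < walk_length (subpath_in P H) \<and>
           diametrical_path H (subpath_in P H)))"

definition maximum_split_set :: "'a graph \<Rightarrow> 'a set set \<Rightarrow> bool" where
  "maximum_split_set T M \<longleftrightarrow> split_set T M \<and> (\<forall>N. split_set T N \<longrightarrow> card N \<le> card M)"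

end

theory Submission
  imports Defs
begin

text \<open>
  Fix a diametrical path with vertices \<open>0, \<dots>, d\<close>; every vertex \<open>v\<close> of the tree projects to a path
  vertex \<open>proj v\<close> and lies at height \<open>ht v\<close> above it.

  \<^emph>\<open>Upper bound.\<close> A split-set with \<open>m\<close> edges cuts the tree into \<open>m + 1\<close> balls around the centres of
  the subpaths, with radii of total \<open>(d - m) / 2\<close>. Raising by one the radius of every third ball (and
  of the last one if needed) keeps the broadcast bn-independent, because a raised ball only gains
  boundary vertices of its two neighbours; now every ball shares a vertex with another ball, so
  the broadcast is maximal. This costs \<open>m div 3 + 1\<close> extra.

  \<^emph>\<open>Lower bound.\<close> It remains to see \<open>d \<le> 2 * \<gamma> + m\<close> for a maximum split-set. The traces of the balls of
  a dominating broadcast cover the path by intervals, but a branch may be covered by balls centred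
  off the path. Such a surplus of cost is recorded as a debt of the interval. Intervals that
  overlap, have positive debt, or are shorter than their cost allows can be merged with their
  neighbours without raising the total cost. When no merge is possible, the intervals form a
  partition which is a split-set with at least \<open>d - 2 * \<gamma>\<close> edges.
\<close>
section \<open>Distances and bridges\<close>

text \<open>Stated as a relation, so that walks of length \<open>n\<close> become
  \<open>adj G ^^ n\<close> and reachability becomes the reflexive transitive closure.\<close>

definition adj :: "'a graph \<Rightarrow> 'a rel" where
  "adj G = {(u, v). u \<in> verts G \<and> v \<in> verts G \<and> {u, v} \<in> edges G}"

lemma sym_adj: "sym (adj G)"
  by (auto simp: sym_def adj_def insert_commute)

lemma adj_verts: "(u, v) \<in> adj G \<Longrightarrow> u \<in> verts G \<and> v \<in> verts G"
  by (simp add: adj_def)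

lemma relpow_adj_sym: "(u, v) \<in> adj G ^^ n \<Longrightarrow> (v, u) \<in> adj G ^^ n"
proof (induction n arbitrary: v)
  case (Suc n)
  then obtain w where "(u, w) \<in> adj G ^^ n" "(w, v) \<in> adj G" by auto
  with Suc.IH[of w] show ?case
    by (meson relpow_Suc_I2 symE[OF sym_adj])
qed simp

lemma relpow_adj_verts: "(u, v) \<in> adj G ^^ n \<Longrightarrow> u \<in> verts G \<Longrightarrow> v \<in> verts G"
  by (induction n arbitrary: v) (auto dest: adj_verts)

lemma walk_map:
  "walk G (map f [0..<Suc n]) \<longleftrightarrow> f 0 \<in> verts G \<and> (\<forall>i<n. (f i, f (Suc i)) \<in> adj G)" (is "_ \<longleftrightarrow> ?R")
proof -
  have nth: "map f [0..<Suc n] ! i = f i" if "i \<le> n" for i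
    using that by (simp del: upt_Suc)
  have len: "length (map f [0..<Suc n]) = Suc n" by simp
  have "walk G (map f [0..<Suc n]) \<longleftrightarrow>
      (\<forall>i\<le>n. f i \<in> verts G) \<and> (\<forall>i<n. {f i, f (Suc i)} \<in> edges G)"
    unfolding walk_def successively_conv_nth len
    by (auto simp: nth image_subset_iff simp del: upt_Suc)
  also have "\<dots> \<longleftrightarrow> ?R"
  proof
    assume R: ?R
    have "f i \<in> verts G" if "i \<le> n" for i
    proof (cases i)
      case (Suc k)
      then show ?thesis using that R adj_verts[of "f k" "f (Suc k)" G] by simp
    qed (use R in simp)
    with R show "(\<forall>i\<le>n. f i \<in> verts G) \<and> (\<forall>i<n. {f i, f (Suc i)} \<in> edges G)"
      by (simp add: adj_def)
  qed (simp add: adj_def)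
  finally show ?thesis .
qed

lemma walk_iff_relpow:
  "(\<exists>xs. walk G xs \<and> hd xs = u \<and> last xs = v \<and> walk_length xs = n)
     \<longleftrightarrow> u \<in> verts G \<and> (u, v) \<in> adj G ^^ n" (is "?L \<longleftrightarrow> ?R")
proof
  assume ?L
  then obtain xs where xs: "walk G xs" "hd xs = u" "last xs = v" "walk_length xs = n" by blast
  then have ne: "xs \<noteq> []" and len: "length xs = Suc n"
    by (auto simp: walk_def walk_length_def)
  have eq: "map ((!) xs) [0..<Suc n] = xs" using len map_nth by metis
  with xs walk_map[of G "(!) xs" n] have w: "xs ! 0 \<in> verts G" "\<forall>i<n. (xs ! i, xs ! Suc i) \<in> adj G"
    by auto
  moreover have "xs ! 0 = u" "xs ! n = v" using xs ne len by (auto simp: hd_conv_nth last_conv_nth)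
  ultimately show ?R unfolding relpow_fun_conv by auto
next
  assume ?R
  then obtain f where f: "f 0 = u" "f n = v" "\<forall>i<n. (f i, f (Suc i)) \<in> adj G" "u \<in> verts G"
    unfolding relpow_fun_conv by auto
  then have "walk G (map f [0..<Suc n])" using walk_map by blast
  moreover have "hd (map f [0..<Suc n]) = u" "last (map f [0..<Suc n]) = v"
    using f by (auto simp: hd_map hd_append last_map simp del: upt_Suc)
  ultimately show ?L by (intro exI[of _ "map f [0..<Suc n]"]) (simp add: walk_length_def)
qed

lemma gdist_eq_Least: "u \<in> verts G \<Longrightarrow> gdist G u v = (LEAST n. (u, v) \<in> adj G ^^ n)"
  unfolding gdist_def walk_iff_relpow by simp

lemma reachable_iff: "reachable G u v \<longleftrightarrow> u \<in> verts G \<and> (u, v) \<in> (adj G)\<^sup>*"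
  using walk_iff_relpow[of G u v] unfolding reachable_def rtrancl_is_UN_relpow by blast

lemma gdist_le: "u \<in> verts G \<Longrightarrow> (u, v) \<in> adj G ^^ n \<Longrightarrow> gdist G u v \<le> n"
  by (simp add: gdist_eq_Least Least_le)

lemma relpow_gdist: "reachable G u v \<Longrightarrow> (u, v) \<in> adj G ^^ gdist G u v"
  unfolding reachable_iff rtrancl_is_UN_relpow using gdist_eq_Least[of u G v]
  by (auto intro: LeastI)

lemma reachable_verts: "reachable G u v \<Longrightarrow> v \<in> verts G"
  using relpow_gdist relpow_adj_verts reachable_iff by metis

lemma gdist_self: "u \<in> verts G \<Longrightarrow> gdist G u u = 0"
  using gdist_le[of u G u 0] by simp

text \<open>Every segment of a shortest walk is shortest, because a shorter replacement would
  shorten the whole walk.\<close>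

lemma gdist_geodesic:
  assumes "reachable G u v"
  obtains f where "f 0 = u" "f (gdist G u v) = v"
    "\<And>i. i < gdist G u v \<Longrightarrow> (f i, f (Suc i)) \<in> adj G"
    "\<And>i j. i \<le> j \<Longrightarrow> j \<le> gdist G u v \<Longrightarrow> gdist G (f i) (f j) = j - i"
    "\<And>i. i \<le> gdist G u v \<Longrightarrow> f i \<in> verts G"
proof -
  let ?n = "gdist G u v"
  obtain f where f: "f 0 = u" "f ?n = v" "\<And>i. i < ?n \<Longrightarrow> (f i, f (Suc i)) \<in> adj G"
    using relpow_gdist[OF assms] unfolding relpow_fun_conv by blast
  have u: "u \<in> verts G" using assms reachable_iff by metis
  have seg: "(f i, f (i + k)) \<in> adj G ^^ k" if "i + k \<le> ?n" for i k
    using that by (induction k) (use f(3) in auto)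
  have fv: "f i \<in> verts G" if "i \<le> ?n" for i
    using seg[of 0 i] that f(1) u relpow_adj_verts by fastforce
  have "gdist G (f i) (f j) = j - i" if "i \<le> j" "j \<le> ?n" for i j
  proof -
    have le: "gdist G (f i) (f j) \<le> j - i"
      using seg[of i "j - i"] that fv gdist_le by fastforce
    have "reachable G (f i) (f j)"
      unfolding reachable_iff rtrancl_is_UN_relpow using seg[of i "j - i"] that fv by auto
    then have "(f i, f j) \<in> adj G ^^ gdist G (f i) (f j)" by (rule relpow_gdist)
    moreover have "(u, f i) \<in> adj G ^^ i" using seg[of 0 i] that f(1) by auto
    moreover have "(f j, v) \<in> adj G ^^ (?n - j)" using seg[of j "?n - j"] that f(2) by auto
    ultimately have "(u, v) \<in> adj G ^^ (i + gdist G (f i) (f j) + (?n - j))"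
      unfolding relpow_add by blast
    then have "?n \<le> i + gdist G (f i) (f j) + (?n - j)" using gdist_le u by metis
    with le that show ?thesis by linarith
  qed
  with f fv that show ?thesis by blast
qed

lemma connected_reachable:
  "connected_graph G \<Longrightarrow> u \<in> verts G \<Longrightarrow> v \<in> verts G \<Longrightarrow> reachable G u v"
  by (simp add: connected_graph_def)

lemma gdist_triangle:
  assumes "connected_graph G" "u \<in> verts G" "v \<in> verts G" "w \<in> verts G"
  shows "gdist G u w \<le> gdist G u v + gdist G v w"
proof -
  have "(u, w) \<in> adj G ^^ (gdist G u v + gdist G v w)"
    unfolding relpow_add using relpow_gdist connected_reachable assms by (metis relcomp.relcompI)
  then show ?thesis using gdist_le assms by metis
qed

lemma gdist_commute:
  assumes "connected_graph G" "u \<in> verts G" "v \<in> verts G"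
  shows "gdist G u v = gdist G v u"
proof -
  have "(u, v) \<in> adj G ^^ n \<longleftrightarrow> (v, u) \<in> adj G ^^ n" for n using relpow_adj_sym by metis
  then show ?thesis using assms by (simp add: gdist_eq_Least)
qed

lemma gdist_eq_0:
  assumes "connected_graph G" "u \<in> verts G" "v \<in> verts G" "gdist G u v = 0"
  shows "u = v"
  using relpow_gdist[OF connected_reachable[OF assms(1-3)]] assms(4) by simp

lemma gdist_le_ecc: "finite (verts G) \<Longrightarrow> u \<in> verts G \<Longrightarrow> gdist G v u \<le> ecc G v"
  unfolding ecc_def by simp

lemma ecc_le_diam: "finite (verts G) \<Longrightarrow> v \<in> verts G \<Longrightarrow> ecc G v \<le> diam G"
  unfolding diam_def by simp

lemma gdist_le_diam:
  "finite (verts G) \<Longrightarrow> u \<in> verts G \<Longrightarrow> v \<in> verts G \<Longrightarrow> gdist G u v \<le> diam G"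
  using gdist_le_ecc ecc_le_diam le_trans by metis

lemma diam_eqI:
  assumes "finite (verts G)" "\<And>u v. u \<in> verts G \<Longrightarrow> v \<in> verts G \<Longrightarrow> gdist G u v \<le> n"
    and "a \<in> verts G" "b \<in> verts G" "gdist G a b = n"
  shows "diam G = n"
proof (rule antisym)
  have ne: "verts G \<noteq> {}" using assms(3) by blast
  show "diam G \<le> n"
    unfolding diam_def ecc_def using assms(1,2) ne by auto
  show "n \<le> diam G" using gdist_le_diam[OF assms(1,3,4)] assms(5) by simp
qed

section \<open>The two sides of a tree edge\<close>

definition side :: "'a graph \<Rightarrow> 'a \<Rightarrow> 'a \<Rightarrow> 'a set" where
  "side G a b = {x. reachable (delete_edges G {{a, b}}) a x}"

lemma adj_delete_edges: "(u, v) \<in> adj (delete_edges G M) \<longleftrightarrow> (u, v) \<in> adj G \<and> {u, v} \<notin> M"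
  by (auto simp: adj_def delete_edges_def)

lemma verts_delete_edges [simp]: "verts (delete_edges G M) = verts G"
  by (simp add: delete_edges_def)

lemma reachable_trans: "reachable G u v \<Longrightarrow> reachable G v w \<Longrightarrow> reachable G u w"
  by (auto simp: reachable_iff)

lemma reachable_commute: "reachable G u v \<Longrightarrow> reachable G v u"
  using reachable_verts[of G u v] by (auto simp: reachable_iff symD[OF sym_rtrancl[OF sym_adj]])

lemma reachable_adj: "(u, v) \<in> adj G \<Longrightarrow> reachable G u v"
  by (auto simp: reachable_iff dest: adj_verts)

lemma tree_connected: "tree G \<Longrightarrow> connected_graph G"
  by (simp add: tree_def)

lemma tree_finite: "tree G \<Longrightarrow> finite (verts G)"
  by (simp add: tree_def connected_graph_def simple_graph_def)

lemma adj_irrefl: "simple_graph G \<Longrightarrow> (u, u) \<notin> adj G"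
  by (force simp: simple_graph_def adj_def doubleton_eq_iff)

text \<open>A shortest walk from \<open>a\<close> to \<open>b\<close> avoiding the edge repeats no
  vertex and has length at least 2, so the edge closes it to a cycle.\<close>

lemma tree_bridge:
  assumes T: "tree G" and ab: "(a, b) \<in> adj G"
  shows "\<not> reachable (delete_edges G {{a, b}}) a b"
proof
  let ?H = "delete_edges G {{a, b}}"
  assume r: "reachable ?H a b"
  let ?n = "gdist ?H a b"
  have "a \<noteq> b" using ab T adj_irrefl by (metis connected_graph_def tree_connected)
  obtain f where f: "f 0 = a" "f ?n = b" "\<And>i. i < ?n \<Longrightarrow> (f i, f (Suc i)) \<in> adj ?H"
    "\<And>i j. i \<le> j \<Longrightarrow> j \<le> ?n \<Longrightarrow> gdist ?H (f i) (f j) = j - i"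
    "\<And>i. i \<le> ?n \<Longrightarrow> f i \<in> verts ?H"
    using gdist_geodesic[OF r] by blast
  have inj: "inj_on f {0..<Suc ?n}"
  proof (rule linorder_inj_onI)
    fix i j assume "i < j" "i \<in> {0..<Suc ?n}" "j \<in> {0..<Suc ?n}"
    then show "f i \<noteq> f j" using f(4)[of i j] f(4)[of i i] by auto
  qed auto
  have "?n \<noteq> 0" using f(1,2) \<open>a \<noteq> b\<close> by metis
  moreover have "?n \<noteq> 1"
    using f(3)[of 0] f(1,2) by (auto simp: adj_delete_edges)
  ultimately have n: "2 \<le> ?n" by linarith
  let ?xs = "map f [0..<Suc ?n]"
  have "walk G ?xs"
    unfolding walk_map using f(3,5) by (auto simp: adj_delete_edges)
  moreover have "distinct ?xs" using inj by (simp add: distinct_map del: upt_Suc)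
  moreover have "hd ?xs = a" "last ?xs = b"
    using f by (auto simp: hd_map hd_append last_map simp del: upt_Suc)
  ultimately have "graph_cycle G ?xs"
    using n ab unfolding graph_cycle_def graph_path_def
    by (simp add: adj_def insert_commute del: upt_Suc)
  with T show False by (auto simp: tree_def)
qed

lemma side_verts: "side G a b \<subseteq> verts G"
  unfolding side_def using reachable_verts by fastforce

lemma side_disjoint:
  assumes "tree G" "(a, b) \<in> adj G" shows "side G a b \<inter> side G b a = {}"
proof -
  have "{{b, a}} = {{a, b}}" by (auto simp: insert_commute)
  with tree_bridge[OF assms] show ?thesis
    unfolding side_def by (auto dest: reachable_commute reachable_trans)
qed

lemma side_step:
  assumes "x \<in> side G a b" "(x, y) \<in> adj G" "{x, y} \<noteq> {a, b}"
  shows "y \<in> side G a b"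
  using assms reachable_trans[OF _ reachable_adj] by (fastforce simp: side_def adj_delete_edges)

lemma side_self: "a \<in> verts G \<Longrightarrow> a \<in> side G a b"
  by (simp add: side_def reachable_iff)

text \<open>A walk from \<open>a\<close> can change sides only along the edge \<open>{a, b}\<close>,
  and then it arrives at an endpoint of that edge.\<close>

lemma side_cover:
  assumes T: "tree G" and ab: "(a, b) \<in> adj G"
  shows "side G a b \<union> side G b a = verts G"
proof
  show "side G a b \<union> side G b a \<subseteq> verts G"
    using side_verts[of G a b] side_verts[of G b a] by simp
  show "verts G \<subseteq> side G a b \<union> side G b a"
  proof
    fix x assume "x \<in> verts G"
    then have "(a, x) \<in> (adj G)\<^sup>*"
      using connected_reachable[OF tree_connected[OF T]] ab adj_verts reachable_iff by metis
    then show "x \<in> side G a b \<union> side G b a"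
    proof induction
      case base
      show ?case using side_self[of a G b] adj_verts[OF ab] by simp
    next
      case (step y z)
      show ?case
      proof (cases "{y, z} = {a, b}")
        case True
        then have "z = a \<or> z = b" by (auto simp: doubleton_eq_iff)
        then show ?thesis using side_self[of a G b] side_self[of b G a] adj_verts[OF ab] by auto
      next
        case False
        then have "{y, z} \<noteq> {b, a}" by (simp add: insert_commute)
        with False step.hyps(2) step.IH side_step[of y G a b z] side_step[of y G b a z]
        show ?thesis by blast
      qed
    qed
  qed
qed

lemma side_crossing:
  assumes "tree G" "(a, b) \<in> adj G" "x \<in> side G a b" "y \<in> side G b a" "(x, y) \<in> adj G"
  shows "x = a \<and> y = b"
proof -
  have "{x, y} = {a, b}"
    using side_step[OF assms(3,5)] side_disjoint[OF assms(1,2)] assms(4) by blast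
  moreover have "x \<noteq> b" using side_disjoint[OF assms(1,2)] side_self[of b G a] adj_verts[OF assms(2)] assms(3) by blast
  ultimately show ?thesis by (auto simp: doubleton_eq_iff)
qed

text \<open>A geodesic from \<open>x\<close> to \<open>y\<close> must change sides and can do so
  only from \<open>a\<close> to \<open>b\<close>; it splits there into two geodesics.\<close>

lemma gdist_across:
  assumes T: "tree G" and ab: "(a, b) \<in> adj G" and x: "x \<in> side G a b" and y: "y \<in> side G b a"
  shows "gdist G x y = gdist G x a + 1 + gdist G b y"
proof (rule antisym)
  note C = tree_connected[OF T]
  have v: "x \<in> verts G" "y \<in> verts G" "a \<in> verts G" "b \<in> verts G"
    using x y ab side_verts adj_verts by fast+
  have "gdist G a b \<le> 1" using gdist_le[of a G b 1] v ab by simp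
  then show "gdist G x y \<le> gdist G x a + 1 + gdist G b y"
    using gdist_triangle[OF C, of x a y] gdist_triangle[OF C, of a b y] v by linarith
  let ?n = "gdist G x y"
  obtain f where f: "f 0 = x" "f ?n = y" "\<And>i. i < ?n \<Longrightarrow> (f i, f (Suc i)) \<in> adj G"
    "\<And>i j. i \<le> j \<Longrightarrow> j \<le> ?n \<Longrightarrow> gdist G (f i) (f j) = j - i"
    "\<And>i. i \<le> ?n \<Longrightarrow> f i \<in> verts G"
    using gdist_geodesic[OF connected_reachable[OF C v(1,2)]] by blast
  have "\<exists>k<?n. f k \<in> side G a b \<and> f (Suc k) \<in> side G b a"
  proof (rule ccontr)
    assume no: "\<not> ?thesis"
    have "i \<le> ?n \<Longrightarrow> f i \<in> side G a b" for i
    proof (induction i)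
      case (Suc i)
      then show ?case using no f(5)[of "Suc i"] side_cover[OF T ab] by fastforce
    qed (use f(1) x in simp)
    then have "y \<in> side G a b" using f(2) by force
    then show False using y side_disjoint[OF T ab] by blast
  qed
  then obtain k where k: "k < ?n" "f k \<in> side G a b" "f (Suc k) \<in> side G b a" by blast
  then have "f k = a" "f (Suc k) = b" using side_crossing[OF T ab] f(3) by blast+
  then have "gdist G x a = k" "gdist G b y = ?n - Suc k"
    using f(4)[of 0 k] f(4)[of "Suc k" ?n] f(1,2) k(1) by auto
  then show "gdist G x a + 1 + gdist G b y \<le> ?n" using k(1) by linarith
qed

section \<open>Projection to a diametrical path\<close>

locale tree_diametrical_path =
  fixes T :: "'a graph" and P :: "'a list"
  assumes tree: "tree T" and path: "diametrical_path T P"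
begin

abbreviation V where "V \<equiv> verts T"
abbreviation d where "d \<equiv> diam T"
abbreviation p where "p i \<equiv> P ! i"

definition left where "left i = side T (p i) (p (Suc i))"
definition right where "right i = side T (p (Suc i)) (p i)"
text \<open>The index of the path vertex to which the branch of \<open>v\<close> is attached: the
  first path edge with \<open>v\<close> on its left. The alternative \<open>i = d\<close> serves the
  branch at the last vertex, which is to the right of every edge.\<close>

definition proj where "proj v = (LEAST i. i = d \<or> v \<in> left i)"
definition ht where "ht v = gdist T v (p (proj v))"

lemmas conn = tree_connected[OF tree]
lemmas fin = tree_finite[OF tree]

lemma P_eq: "P = map p [0..<Suc d]"
proof -
  have "length P = Suc d"
    using path by (cases P) (auto simp: diametrical_path_def graph_path_def walk_def walk_length_def)
  then show ?thesis using map_nth by metis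
qed

lemma length_P: "length P = Suc d"
  using arg_cong[OF P_eq, of length] by simp

lemma p_inj: "i \<le> d \<Longrightarrow> j \<le> d \<Longrightarrow> p i = p j \<longleftrightarrow> i = j"
  using path length_P by (auto simp: diametrical_path_def graph_path_def nth_eq_iff_index_eq)

lemma p_adj: "i < d \<Longrightarrow> (p i, p (Suc i)) \<in> adj T"
  using path walk_map[of T p d] P_eq by (simp add: diametrical_path_def graph_path_def)

lemma p_verts: "i \<le> d \<Longrightarrow> p i \<in> V"
  using path length_P by (auto simp: diametrical_path_def graph_path_def walk_def)

lemma left_right_disjoint: "i < d \<Longrightarrow> v \<in> left i \<Longrightarrow> v \<in> right i \<Longrightarrow> False"
  using side_disjoint[OF tree p_adj] by (auto simp: left_def right_def)

lemma left_or_right: "i < d \<Longrightarrow> v \<in> V \<Longrightarrow> v \<in> left i \<or> v \<in> right i"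
  using side_cover[OF tree p_adj] by (auto simp: left_def right_def)

lemma across:
  "i < d \<Longrightarrow> u \<in> left i \<Longrightarrow> v \<in> right i \<Longrightarrow>
     gdist T u v = gdist T u (p i) + 1 + gdist T (p (Suc i)) v"
  unfolding left_def right_def by (rule gdist_across[OF tree p_adj])

lemma path_edge_eq:
  "i < d \<Longrightarrow> j < d \<Longrightarrow> {p i, p (Suc i)} = {p j, p (Suc j)} \<longleftrightarrow> i = j"
  by (auto simp: doubleton_eq_iff p_inj)

lemma p_left: "k \<le> i \<Longrightarrow> i < d \<Longrightarrow> p k \<in> left i"
proof (induction "i - k" arbitrary: k)
  case 0
  then show ?case by (simp add: left_def side_self p_verts)
next
  case (Suc n)
  then have "p (Suc k) \<in> left i" by simp
  moreover have "(p (Suc k), p k) \<in> adj T"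
    using p_adj[of k] Suc.prems Suc.hyps sym_adj[of T] by (simp add: sym_def)
  moreover have "{p (Suc k), p k} \<noteq> {p i, p (Suc i)}"
    using path_edge_eq[of k i] Suc.prems Suc.hyps by (simp add: insert_commute)
  ultimately show ?case unfolding left_def by (rule side_step)
qed

lemma p_right: "i < k \<Longrightarrow> k \<le> d \<Longrightarrow> p k \<in> right i"
proof (induction k)
  case (Suc k)
  show ?case
  proof (cases "k = i")
    case True
    then show ?thesis using Suc.prems by (simp add: right_def side_self p_verts)
  next
    case False
    then have "p k \<in> right i" using Suc by simp
    moreover have "(p k, p (Suc k)) \<in> adj T" using p_adj Suc.prems by simp
    moreover have "{p k, p (Suc k)} \<noteq> {p (Suc i), p i}"
      using path_edge_eq[of k i] Suc.prems False by (simp add: insert_commute)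
    ultimately show ?thesis unfolding right_def by (rule side_step)
  qed
qed simp

lemma left_verts: "v \<in> left i \<Longrightarrow> v \<in> V"
  using side_verts by (fastforce simp: left_def)

text \<open>If \<open>v\<close> were to the right of the next edge, \<open>p (Suc (Suc i))\<close>
  would be nearer to \<open>v\<close> than \<open>p (Suc i)\<close>; but being to the left of edge
  \<open>i\<close> makes it farther.\<close>

lemma left_Suc: assumes "Suc i < d" "v \<in> left i" shows "v \<in> left (Suc i)"
proof (rule ccontr)
  assume "v \<notin> left (Suc i)"
  then have "v \<in> right (Suc i)" using left_or_right assms left_verts by metis
  then have "gdist T (p (Suc i)) v = gdist T (p (Suc i)) (p (Suc i)) + 1 + gdist T (p (Suc (Suc i))) v"
    using across[of "Suc i" "p (Suc i)" v] p_left assms by simp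
  moreover have "gdist T (p (Suc i)) (p (Suc (Suc i))) =
      gdist T (p (Suc i)) (p (Suc i)) + 1 + gdist T (p (Suc (Suc i))) (p (Suc (Suc i)))"
    by (rule across) (use p_left p_right assms in simp_all)
  moreover have "gdist T v (p (Suc (Suc i))) = gdist T v (p i) + 1 + gdist T (p (Suc i)) (p (Suc (Suc i)))"
    "gdist T v (p (Suc i)) = gdist T v (p i) + 1 + gdist T (p (Suc i)) (p (Suc i))"
    by (rule across; use p_right assms in simp)+
  moreover have "gdist T (p (Suc i)) v = gdist T v (p (Suc i))"
    "gdist T (p (Suc (Suc i))) v = gdist T v (p (Suc (Suc i)))"
    using gdist_commute[OF conn] p_verts assms left_verts by simp_all
  ultimately show False using assms by (simp add: gdist_self p_verts)
qed

lemma left_mono: "i \<le> j \<Longrightarrow> j < d \<Longrightarrow> v \<in> left i \<Longrightarrow> v \<in> left j"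
  by (induction j) (auto simp: le_Suc_eq intro: left_Suc)

lemma proj_le: "proj v \<le> d"
  unfolding proj_def by (rule Least_le) simp

lemma proj_left: "proj v \<le> i \<Longrightarrow> i < d \<Longrightarrow> v \<in> left i"
  using LeastI[of "\<lambda>i. i = d \<or> v \<in> left i" d] left_mono[of "proj v" i v] by (auto simp: proj_def)

lemma proj_right: "v \<in> V \<Longrightarrow> i < proj v \<Longrightarrow> v \<in> right i"
  using not_less_Least[of i "\<lambda>i. i = d \<or> v \<in> left i"] left_or_right[of i v] proj_le[of v]
  by (auto simp: proj_def)

lemma proj_p: "i \<le> d \<Longrightarrow> proj (p i) = i"
proof (rule antisym)
  assume i: "i \<le> d"
  show "proj (p i) \<le> i"
    using proj_right[OF p_verts[OF i], of i] p_left[of i i] left_right_disjoint[of i "p i"]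
      proj_le[of "p i"] i by (metis le_refl less_le_trans not_less)
  show "i \<le> proj (p i)"
    using proj_left[of "p i" "proj (p i)"] p_right[of "proj (p i)" i]
      left_right_disjoint[of "proj (p i)" "p i"] i by force
qed

lemma gdist_p_right:
  assumes "v \<in> V" "proj v \<le> i" "i \<le> d" shows "gdist T v (p i) = ht v + (i - proj v)"
  using assms(2,3)
proof (induction i)
  case 0
  then show ?case by (simp add: ht_def)
next
  case (Suc i)
  show ?case
  proof (cases "proj v = Suc i")
    case False
    have "gdist T v (p (Suc i)) = gdist T v (p i) + 1 + gdist T (p (Suc i)) (p (Suc i))"
      using across[of i v "p (Suc i)"] proj_left[of v i] p_right False Suc.prems by simp
    with Suc False show ?thesis by (simp add: gdist_self p_verts)
  qed (simp add: ht_def)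
qed

lemma gdist_p_left:
  assumes "v \<in> V" "i \<le> proj v" shows "gdist T v (p i) = ht v + (proj v - i)"
  using assms(2)
proof (induction "proj v - i" arbitrary: i)
  case 0
  then show ?case by (simp add: ht_def)
next
  case (Suc n)
  then have i: "i < proj v" "i < d" using proj_le[of v] by simp_all
  have "gdist T (p i) v = gdist T (p i) (p i) + 1 + gdist T (p (Suc i)) v"
    using across[of i "p i" v] proj_right[of v i] p_left i assms by simp
  moreover have "gdist T v (p (Suc i)) = ht v + (proj v - Suc i)" using Suc i by simp
  ultimately show ?case
    using gdist_self[OF p_verts[of i]] gdist_commute[OF conn assms(1) p_verts[of i]] 
      gdist_commute[OF conn assms(1) p_verts[of "Suc i"]] i by simp
qed

lemma gdist_p: "v \<in> V \<Longrightarrow> i \<le> d \<Longrightarrow> int (gdist T v (p i)) = int (ht v) + \<bar>int i - int (proj v)\<bar>"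
  using gdist_p_left[of v i] gdist_p_right[of v i] by (cases "i \<le> proj v") auto

lemma ht_p: "i \<le> d \<Longrightarrow> ht (p i) = 0"
  by (simp add: ht_def proj_p gdist_self p_verts)

lemma ht_0: "v \<in> V \<Longrightarrow> ht v = 0 \<Longrightarrow> v = p (proj v)"
  using gdist_eq_0[OF conn] p_verts proj_le by (metis ht_def)

text \<open>A geodesic between different branches descends to the path, follows it and climbs again;
  it is split at the edge after \<open>proj u\<close>.\<close>

lemma gdist_proj_less:
  assumes "u \<in> V" "v \<in> V" "proj u < proj v"
  shows "gdist T u v = ht u + ht v + (proj v - proj u)"
proof -
  let ?i = "proj u"
  have i: "?i < d" using assms proj_le[of v] by simp
  have "gdist T u v = gdist T u (p ?i) + 1 + gdist T (p (Suc ?i)) v"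
    by (rule across) (use i assms proj_left proj_right in auto)
  moreover have "gdist T v (p (Suc ?i)) = ht v + (proj v - Suc ?i)"
    using gdist_p_left[of v "Suc ?i"] assms by simp
  ultimately show ?thesis
    using gdist_commute[OF conn assms(2) p_verts[of "Suc ?i"]] i assms by (simp add: ht_def)
qed

lemma gdist_proj_neq:
  assumes "u \<in> V" "v \<in> V" "proj u \<noteq> proj v"
  shows "int (gdist T u v) = int (ht u) + int (ht v) + \<bar>int (proj v) - int (proj u)\<bar>"
  using gdist_proj_less[of u v] gdist_proj_less[of v u] assms gdist_commute[OF conn assms(1,2)]
  by (cases "proj u < proj v") auto

lemma gdist_proj_le:
  assumes "u \<in> V" "v \<in> V"
  shows "int (gdist T u v) \<le> int (ht u) + int (ht v) + \<bar>int (proj v) - int (proj u)\<bar>"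
proof (cases "proj u = proj v")
  case True
  then show ?thesis
    using gdist_triangle[OF conn assms(1) p_verts[OF proj_le[of u]] assms(2)]
      gdist_commute[OF conn assms(2) p_verts[OF proj_le[of v]]] by (simp add: ht_def)
qed (use gdist_proj_neq[OF assms] in simp)

text \<open>The path is diametrical, so the distances from \<open>v\<close> to both of its ends are
  at most \<open>d\<close>.\<close>

lemma ht_le: assumes "v \<in> V" shows "ht v \<le> proj v" "ht v + proj v \<le> d"
  using gdist_p[OF assms, of d] gdist_p[OF assms, of 0] gdist_le_diam[OF fin assms p_verts, of 0]
    gdist_le_diam[OF fin assms p_verts, of d] proj_le[of v] by linarith+

text \<open>A vertex \<open>z\<close> of a geodesic that projects outside the interval lies in
  another branch than both ends. Then both partial distances are exact, and the detour makes their
  sum too large.\<close>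

lemma proj_convex:
  assumes "u \<in> V" "w \<in> V" "z \<in> V" "gdist T u z + gdist T z w = gdist T u w"
    and "x \<le> proj u" "proj u \<le> y" "x \<le> proj w" "proj w \<le> y"
  shows "x \<le> proj z \<and> proj z \<le> y"
proof (rule ccontr)
  assume "\<not> ?thesis"
  then have "proj z \<noteq> proj u" "proj z \<noteq> proj w" 
    "\<bar>int (proj z) - int (proj u)\<bar> + \<bar>int (proj w) - int (proj z)\<bar> > \<bar>int (proj w) - int (proj u)\<bar>"
    using assms by auto
  then show False
    using gdist_proj_neq[of u z] gdist_proj_neq[of z w] gdist_proj_le[of u w] assms(1-4) by linarith
qed

text \<open>With different projections, distance 1 leaves no room for positive heights.\<close>

lemma adj_crossing:
  assumes "(u, w) \<in> adj T" "proj u < proj w"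
  shows "u = p (proj u) \<and> w = p (Suc (proj u)) \<and> proj w = Suc (proj u)"
proof -
  have v: "u \<in> V" "w \<in> V" using assms adj_verts by fast+
  have "gdist T u w \<le> 1" using gdist_le[of u T w 1] assms v by simp
  then have "ht u = 0" "ht w = 0" "proj w = Suc (proj u)"
    using gdist_proj_less[OF v] assms by linarith+
  then show ?thesis using ht_0 v by metis
qed

section \<open>Blocks of the path left by cutting some of its edges\<close>

abbreviation cut where "cut I \<equiv> (\<lambda>i. {p i, p (Suc i)}) ` I"

text \<open>A maximal run of path indices between consecutive cuts. An index \<open>i\<close> in
  \<open>I\<close> stands for the edge from \<open>p i\<close> to \<open>p (Suc i)\<close>, hence
  \<open>x - 1\<close> on the left but \<open>y\<close> on the right.\<close>

definition is_block where
  "is_block I x y \<longleftrightarrow> x \<le> y \<and> y \<le> d \<and> (x = 0 \<or> x - 1 \<in> I) \<and> (y = d \<or> y \<in> I) \<and> I \<inter> {x..<y} = {}"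

definition slab where "slab x y = {v \<in> V. x \<le> proj v \<and> proj v \<le> y}"

context
  fixes I x y
  assumes I: "I \<subseteq> {..<d}" and block: "is_block I x y"
begin

abbreviation "H \<equiv> induced_subgraph (delete_edges T (cut I)) (slab x y)"

lemma verts_H: "verts H = slab x y"
  by (simp add: induced_subgraph_def)

lemma adj_slab:
  assumes "(u, w) \<in> adj T" "u \<in> slab x y" "w \<in> slab x y"
  shows "(u, w) \<in> adj H"
proof -
  have "{u, w} \<noteq> {p k, p (Suc k)}" if "k \<in> I" for k
  proof
    assume "{u, w} = {p k, p (Suc k)}"
    then have "p k \<in> slab x y" "p (Suc k) \<in> slab x y" using assms(2,3) by (auto simp: doubleton_eq_iff)
    then have "k \<in> {x..<y}" using that I by (auto simp: slab_def proj_p)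
    with block that show False by (auto simp: is_block_def)
  qed
  with assms show ?thesis by (auto simp: adj_def induced_subgraph_def delete_edges_def)
qed

lemma adj_H: "adj H \<subseteq> adj (delete_edges T (cut I))" "adj H \<subseteq> adj T"
  by (auto simp: adj_def induced_subgraph_def delete_edges_def slab_def)

text \<open>By convexity a geodesic of \<open>T\<close> between vertices of the slab stays in the
  slab, so the slab inherits the distances of \<open>T\<close>.\<close>

lemma relpow_H:
  assumes "u \<in> slab x y" "w \<in> slab x y"
  shows "(u, w) \<in> adj H ^^ gdist T u w"
proof -
  have v: "u \<in> V" "w \<in> V" using assms by (auto simp: slab_def)
  let ?n = "gdist T u w"
  obtain f where f: "f 0 = u" "f ?n = w" "\<And>i. i < ?n \<Longrightarrow> (f i, f (Suc i)) \<in> adj T"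
    "\<And>i j. i \<le> j \<Longrightarrow> j \<le> ?n \<Longrightarrow> gdist T (f i) (f j) = j - i"
    "\<And>i. i \<le> ?n \<Longrightarrow> f i \<in> V"
    using gdist_geodesic[OF connected_reachable[OF conn v]] by blast
  have "f i \<in> slab x y" if "i \<le> ?n" for i
    using proj_convex[OF v f(5)[OF that], of x y] f(4)[of 0 i] f(4)[of i ?n] f(1,2) f(5)[OF that]
      that assms
    by (simp add: slab_def)
  then have "(f i, f (Suc i)) \<in> adj H" if "i < ?n" for i
    using adj_slab f(3) that by simp
  with f(1,2) show ?thesis unfolding relpow_fun_conv by blast
qed

lemma gdist_H:
  assumes "u \<in> slab x y" "w \<in> slab x y"
  shows "gdist H u w = gdist T u w"
proof (rule antisym)
  have u: "u \<in> verts H" "u \<in> V" using assms unfolding verts_H by (auto simp: slab_def)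
  show "gdist H u w \<le> gdist T u w" using gdist_le[OF u(1)] relpow_H[OF assms] by blast
  have "reachable H u w"
    using relpow_H[OF assms] u by (auto simp: reachable_iff rtrancl_is_UN_relpow)
  then have "(u, w) \<in> adj H ^^ gdist H u w" by (rule relpow_gdist)
  then have "(u, w) \<in> adj T ^^ gdist H u w" using adj_H(2) unfolding relpow_fun_conv by blast
  then show "gdist T u w \<le> gdist H u w" using gdist_le[OF u(2)] by blast
qed

text \<open>Geodesics inside the slab connect it; a step out of it would use a path edge at one of
  its two ends, and these edges are cut.\<close>

lemma component_eq_slab:
  assumes v: "v \<in> slab x y"
  shows "{u. reachable (delete_edges T (cut I)) v u} = slab x y"
proof (intro equalityI subsetI)
  fix u assume "u \<in> slab x y"
  then have "(v, u) \<in> (adj H)\<^sup>*"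
    using relpow_H[OF v] unfolding rtrancl_is_UN_relpow by blast
  then have "(v, u) \<in> (adj (delete_edges T (cut I)))\<^sup>*"
    using rtrancl_mono[OF adj_H(1)] by blast
  then show "u \<in> {u. reachable (delete_edges T (cut I)) v u}"
    using v by (simp add: reachable_iff slab_def)
next
  fix u assume "u \<in> {u. reachable (delete_edges T (cut I)) v u}"
  then have "(v, u) \<in> (adj (delete_edges T (cut I)))\<^sup>*" by (simp add: reachable_iff)
  then show "u \<in> slab x y"
  proof induction
    case base
    show ?case using v .
  next
    case (step u w)
    then have uw: "(u, w) \<in> adj T" "{u, w} \<notin> cut I" by (auto simp: adj_delete_edges)
    then have wu: "(w, u) \<in> adj T" "w \<in> V" using symD[OF sym_adj uw(1)] adj_verts[OF uw(1)] by auto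
    show ?case
    proof (rule ccontr)
      assume "w \<notin> slab x y"
      then consider "proj w < x" | "y < proj w" using wu(2) by (force simp: slab_def)
      then show False
      proof cases
        case 1
        then have "proj w < proj u" using step.IH by (simp add: slab_def)
        then have c: "w = p (proj w)" "u = p (Suc (proj w))" "proj u = Suc (proj w)"
          using adj_crossing[OF wu(1)] by blast+
        have "x \<le> proj u" using step.IH by (simp add: slab_def)
        then have "proj w = x - 1" using 1 c(3) by linarith
        then have "proj w \<in> I" using 1 block by (auto simp: is_block_def)
        then have "{p (proj w), p (Suc (proj w))} \<in> cut I" by blast
        then show False using uw(2) c by (metis insert_commute)
      next
        case 2
        then have "proj u < proj w" using step.IH by (simp add: slab_def)
        then have c: "u = p (proj u)" "w = p (Suc (proj u))" "proj w = Suc (proj u)"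
          using adj_crossing[OF uw(1)] by blast+
        have "proj u \<le> y" using step.IH by (simp add: slab_def)
        then have "proj u = y" using 2 c(3) by linarith
        then have "proj u \<in> I" using 2 block proj_le[of w] by (auto simp: is_block_def)
        then have "{p (proj u), p (Suc (proj u))} \<in> cut I" by blast
        then show False using uw(2) c by metis
      qed
    qed
  qed
qed

lemma subpath_slab: "subpath_in P H = map p [x..<Suc y]"
proof -
  have xy: "x \<le> y" "y \<le> d" using block by (auto simp: is_block_def)
  have "[0..<Suc d] = [0..<x] @ [x..<Suc y] @ [Suc y..<Suc d]"
    using upt_add_eq_append[of 0 x "Suc d - x"] upt_add_eq_append[of x "Suc y" "d - y"] xy by simp
  then have "filter (\<lambda>i. x \<le> i \<and> i \<le> y) [0..<Suc d] = [x..<Suc y]"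
    by (simp add: filter_empty_conv filter_id_conv del: upt_Suc)
  moreover have "filter (\<lambda>v. v \<in> verts H) (map p [0..<Suc d]) =
      map p (filter (\<lambda>i. x \<le> i \<and> i \<le> y) [0..<Suc d])"
    unfolding filter_map comp_def verts_H
    by (intro arg_cong[of _ _ "map p"] filter_cong) (auto simp: slab_def p_verts proj_p)
  ultimately show ?thesis using P_eq by (metis subpath_in_def)
qed

lemma walk_length_slab: "walk_length (subpath_in P H) = y - x"
  using block by (simp add: subpath_slab walk_length_def is_block_def del: upt_Suc)

end

end

section \<open>Covering an interval by weighted blocks\<close>

datatype block = Block (lo: int) (hi: int) (wt: int) (debt: int)

text \<open>Each branch meeting a block may stick out by up to three times the debt, and each unit of debt
  keeps two units of length in reserve. Merging a block with both neighbours uses up these two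
  units for the two connecting edges, and lengthens it by at least 3 on each side, so that one unit
  of debt disappears. The last clause guarantees this gain; it fails only for blocks truncated at
  the ends of \<open>{0..d}\<close>, where branches cannot stick out.\<close>

definition good_block :: "int \<Rightarrow> block \<Rightarrow> bool" where
  "good_block d b \<longleftrightarrow> 0 \<le> lo b \<and> lo b \<le> hi b \<and> hi b \<le> d \<and> 1 \<le> wt b \<and> 0 \<le> debt b \<and>
     hi b - lo b + 2 * debt b \<le> 2 * wt b \<and>
     (0 < lo b \<and> hi b < d \<longrightarrow> 2 \<le> hi b - lo b + 3 * debt b)"

text \<open>The function \<open>h\<close> stands for the branch heights: the branch at
  \<open>j\<close> is treated as if it were laid along the path in both directions, from
  \<open>j - h j\<close> to \<open>j + h j\<close>.\<close>

definition block_cover :: "int \<Rightarrow> (int \<Rightarrow> int) \<Rightarrow> block set \<Rightarrow> bool" where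
  "block_cover d h S \<longleftrightarrow> finite S \<and> (\<forall>b\<in>S. good_block d b) \<and>
     (\<forall>j\<in>{0..d}. \<exists>b\<in>S. lo b \<le> j \<and> j \<le> hi b \<and>
        lo b - 3 * debt b \<le> j - h j \<and> j + h j \<le> hi b + 3 * debt b)"

text \<open>Whatever a block of \<open>F\<close> covers is covered by \<open>b'\<close>: domination
  gives the bounds, except where \<open>b'\<close> reaches an end of \<open>{0..d}\<close>, and
  there \<open>h j\<close> is at most the distance from \<open>j\<close> to that end.\<close>

lemma block_cover_merge:
  assumes S: "block_cover d h S" and h: "\<And>j. 0 \<le> j \<Longrightarrow> j \<le> d \<Longrightarrow> 0 \<le> h j \<and> h j \<le> j \<and> h j \<le> d - j"
    and F: "F \<subseteq> S" "2 \<le> card F" and b': "good_block d b'"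
    and dom: "\<And>b. b \<in> F \<Longrightarrow> lo b' \<le> lo b \<and> hi b \<le> hi b' \<and>
      (lo b' = 0 \<or> lo b' - 3 * debt b' \<le> lo b - 3 * debt b) \<and>
      (hi b' = d \<or> hi b + 3 * debt b \<le> hi b' + 3 * debt b')"
    and wt: "wt b' \<le> sum wt F"
  shows "\<exists>S'. block_cover d h S' \<and> card S' < card S \<and> sum wt S' \<le> sum wt S"
proof (intro exI conjI)
  let ?S = "insert b' (S - F)"
  have fin: "finite S" "finite F" using S F(1) finite_subset by (auto simp: block_cover_def)
  have "debt b' \<ge> 0" using b' by (simp add: good_block_def)
  have "\<exists>b\<in>?S. lo b \<le> j \<and> j \<le> hi b \<and> lo b - 3 * debt b \<le> j - h j \<and> j + h j \<le> hi b + 3 * debt b"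
    if j: "j \<in> {0..d}" for j
  proof -
    obtain b where b: "b \<in> S" "lo b \<le> j" "j \<le> hi b" "lo b - 3 * debt b \<le> j - h j"
      "j + h j \<le> hi b + 3 * debt b"
      using S j by (fastforce simp: block_cover_def)
    show ?thesis
    proof (cases "b \<in> F")
      case True
      have "lo b' \<le> j" "j \<le> hi b'" "lo b' - 3 * debt b' \<le> j - h j" "j + h j \<le> hi b' + 3 * debt b'"
        using dom[OF True] b h[of j] j \<open>debt b' \<ge> 0\<close> by auto
      then show ?thesis by blast
    next
      case False
      with b show ?thesis by blast
    qed
  qed
  with S b' show "block_cover d h ?S" by (simp add: block_cover_def)
  have "card ?S \<le> Suc (card (S - F))" using fin by (simp add: card_insert_if)
  also have "\<dots> = Suc (card S - card F)" using card_Diff_subset fin F by metis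
  also have "\<dots> < card S" using F card_mono[OF fin(1) F(1)] by linarith
  finally show "card ?S < card S" .
  have "sum wt ?S \<le> wt b' + sum wt (S - F)"
    using fin b' by (simp add: sum.insert_if good_block_def)
  also have "\<dots> \<le> sum wt F + sum wt (S - F)" using wt by simp
  also have "\<dots> = sum wt S" using sum.subset_diff[OF F(1) fin(1), of wt] by simp
  finally show "sum wt ?S \<le> sum wt S" .
qed

text \<open>Three kinds of merge: two overlapping blocks, a block in debt with its neighbours, a
  block shorter than twice its weight with one neighbour. By the hypothesis on \<open>d\<close> no
  block fills \<open>{0..d}\<close>, so a neighbour exists.\<close>

lemma block_cover_reduce:
  assumes S: "block_cover d h S" and h: "\<And>j. 0 \<le> j \<Longrightarrow> j \<le> d \<Longrightarrow> 0 \<le> h j \<and> h j \<le> j \<and> h j \<le> d - j"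
    and d: "2 * sum wt S < d"
    and bad: "\<not> (\<forall>b\<in>S. debt b = 0 \<and> hi b - lo b = 2 * wt b \<and> (\<forall>c\<in>S. b \<noteq> c \<longrightarrow> hi b < lo c \<or> hi c < lo b))"
  shows "\<exists>S'. block_cover d h S' \<and> card S' < card S \<and> sum wt S' \<le> sum wt S"
proof -
  have fin: "finite S" and good: "\<And>b. b \<in> S \<Longrightarrow> good_block d b"
    and cov: "\<And>j. 0 \<le> j \<Longrightarrow> j \<le> d \<Longrightarrow> \<exists>b\<in>S. lo b \<le> j \<and> j \<le> hi b"
    using S by (auto simp: block_cover_def)
  have wt_le: "wt b \<le> sum wt S" if "b \<in> S" for b
    using that fin by (intro member_le_sum) (auto dest: good simp: good_block_def)
  show ?thesis
  proof (cases "\<exists>b\<in>S. \<exists>c\<in>S. b \<noteq> c \<and> lo c \<le> hi b \<and> lo b \<le> hi c")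
    case True
    then obtain b c where bc: "b \<in> S" "c \<in> S" "b \<noteq> c" "lo c \<le> hi b" "lo b \<le> hi c" by blast
    note gb = good[OF bc(1), unfolded good_block_def]
    note gc = good[OF bc(2), unfolded good_block_def]
    obtain x y where xy: "x = lo b \<or> x = lo c" "x \<le> lo b" "x \<le> lo c" "y = hi b \<or> y = hi c" "hi b \<le> y" "hi c \<le> y"
      by (metis linear)
    \<comment> \<open>The union of overlapping intervals is no longer than both lengths together, so
      weights and debts simply add up.\<close>
    let ?b = "Block x y (wt b + wt c) (debt b + debt c)"
    show ?thesis
    proof (rule block_cover_merge[OF S h, of "{b, c}" ?b])
      show "good_block d ?b"
        using gb gc bc(4,5) xy unfolding good_block_def block.sel by (smt (verit))
      show "lo ?b \<le> lo a \<and> hi a \<le> hi ?b \<and> (lo ?b = 0 \<or> lo ?b - 3 * debt ?b \<le> lo a - 3 * debt a) \<and>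
        (hi ?b = d \<or> hi a + 3 * debt a \<le> hi ?b + 3 * debt ?b)" if "a \<in> {b, c}" for a
      proof -
        from that have "a = b \<or> a = c" by blast
        then show ?thesis using gb gc xy unfolding block.sel by (smt (verit))
      qed
    qed (use bc in auto)
  next
    case False
    then have disj: "hi b < lo c \<or> hi c < lo b" if "b \<in> S" "c \<in> S" "b \<noteq> c" for b c
      using that by force
    \<comment> \<open>The block covering \<open>lo b - 1\<close> is disjoint from \<open>b\<close>,
      so it ends exactly there.\<close>
    have before: "\<exists>l\<in>S. hi l + 1 = lo b" if "b \<in> S" "0 < lo b" for b
    proof -
      note gb = good[OF that(1), unfolded good_block_def]
      have "0 \<le> lo b - 1" "lo b - 1 \<le> d" using gb that by simp_all
      then obtain l where l: "l \<in> S" "lo l \<le> lo b - 1" "lo b - 1 \<le> hi l" using cov by blast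
      then have "l \<noteq> b" by auto
      then have "hi l < lo b \<or> hi b < lo l" using disj l(1) that(1) by blast
      with l gb that show ?thesis by (intro bexI[of _ l]) auto
    qed
    have after: "\<exists>r\<in>S. hi b + 1 = lo r" if "b \<in> S" "hi b < d" for b
    proof -
      note gb = good[OF that(1), unfolded good_block_def]
      have "0 \<le> hi b + 1" "hi b + 1 \<le> d" using gb that by simp_all
      then obtain r where r: "r \<in> S" "lo r \<le> hi b + 1" "hi b + 1 \<le> hi r" using cov by blast
      then have "b \<noteq> r" by auto
      then have "hi b < lo r \<or> hi r < lo b" using disj r(1) that(1) by blast
      with r gb that show ?thesis by (intro bexI[of _ r]) auto
    qed
    have not_full: "0 < lo b \<or> hi b < d" if "b \<in> S" for b
      using wt_le[OF that] good[OF that] d by (auto simp: good_block_def)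
    show ?thesis
    proof (cases "\<exists>b\<in>S. 1 \<le> debt b")
      case True
      then obtain b where b: "b \<in> S" "1 \<le> debt b" by blast
      note gb = good[OF b(1), unfolded good_block_def]
      consider (both) "0 < lo b" "hi b < d" | (left) "0 < lo b" "hi b = d" | (right) "lo b = 0" "hi b < d"
        using not_full[OF b(1)] gb by force
      then show ?thesis
      proof cases
        case both
        obtain l r where lr: "l \<in> S" "hi l + 1 = lo b" "r \<in> S" "hi b + 1 = lo r"
          using before after b both by blast
        note gl = good[OF lr(1), unfolded good_block_def]
        note gr = good[OF lr(3), unfolded good_block_def]
        have ne: "l \<noteq> b" "r \<noteq> b" "l \<noteq> r" using lr gl gb gr by auto
        \<comment> \<open>One unit of debt pays for the two connecting edges. The reach of 3 lost on
          each side is regained from the neighbour there: its length plus three times its debt is at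
          least 2, and the connecting edge adds 1, unless the merged block already reaches the end
          of \<open>{0..d}\<close>.\<close>
        let ?b = "Block (lo l) (hi r) (wt l + wt b + wt r) (debt b - 1 + debt l + debt r)"
        show ?thesis
        proof (rule block_cover_merge[OF S h, of "{l, b, r}" ?b])
          show "good_block d ?b"
            using lr gl gb gr b unfolding good_block_def block.sel by (smt (verit))
          show "lo ?b \<le> lo x \<and> hi x \<le> hi ?b \<and> (lo ?b = 0 \<or> lo ?b - 3 * debt ?b \<le> lo x - 3 * debt x) \<and>
            (hi ?b = d \<or> hi x + 3 * debt x \<le> hi ?b + 3 * debt ?b)" if "x \<in> {l, b, r}" for x
          proof -
            from that have "x = l \<or> x = b \<or> x = r" by blast
            then show ?thesis using lr gl gb gr b both unfolding block.sel by (smt (verit))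
          qed
        qed (use lr b ne in auto)
      next
        case left
        obtain l where l: "l \<in> S" "hi l + 1 = lo b" using before b left by blast
        note gl = good[OF l(1), unfolded good_block_def]
        have ne: "l \<noteq> b" using l gl gb by auto
        \<comment> \<open>On the right the block already ends at \<open>d\<close>, so only the reach
          on the left must be regained.\<close>
        let ?b = "Block (lo l) (hi b) (wt l + wt b) (debt b - 1 + debt l)"
        show ?thesis
        proof (rule block_cover_merge[OF S h, of "{l, b}" ?b])
          show "good_block d ?b"
            using l gl gb b left unfolding good_block_def block.sel by (smt (verit))
          show "lo ?b \<le> lo x \<and> hi x \<le> hi ?b \<and> (lo ?b = 0 \<or> lo ?b - 3 * debt ?b \<le> lo x - 3 * debt x) \<and>
            (hi ?b = d \<or> hi x + 3 * debt x \<le> hi ?b + 3 * debt ?b)" if "x \<in> {l, b}" for x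
          proof -
            from that have "x = l \<or> x = b" by blast
            then show ?thesis using l gl gb b left unfolding block.sel by (smt (verit))
          qed
        qed (use l b ne in auto)
      next
        case right
        obtain r where r: "r \<in> S" "hi b + 1 = lo r" using after b right by blast
        note gr = good[OF r(1), unfolded good_block_def]
        have ne: "b \<noteq> r" using r gr gb by auto
        let ?b = "Block (lo b) (hi r) (wt b + wt r) (debt b - 1 + debt r)"
        show ?thesis
        proof (rule block_cover_merge[OF S h, of "{b, r}" ?b])
          show "good_block d ?b"
            using r gr gb b right unfolding good_block_def block.sel by (smt (verit))
          show "lo ?b \<le> lo x \<and> hi x \<le> hi ?b \<and> (lo ?b = 0 \<or> lo ?b - 3 * debt ?b \<le> lo x - 3 * debt x) \<and>
            (hi ?b = d \<or> hi x + 3 * debt x \<le> hi ?b + 3 * debt ?b)" if "x \<in> {b, r}" for x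
          proof -
            from that have "x = b \<or> x = r" by blast
            then show ?thesis using r gr gb b right unfolding block.sel by (smt (verit))
          qed
        qed (use r b ne in auto)
      qed
    next
      case False
      then have debt: "debt b = 0" if "b \<in> S" for b
        using good[OF that] that by (force simp: good_block_def)
      then obtain b where b: "b \<in> S" "hi b - lo b \<noteq> 2 * wt b" using bad disj by blast
      note gb = good[OF b(1), unfolded good_block_def]
      have "\<exists>l\<in>S. \<exists>r\<in>S. hi l + 1 = lo r \<and> (l = b \<or> r = b)"
        using not_full[OF b(1)] before[OF b(1)] after[OF b(1)] b(1) by blast
      then obtain l r where lr: "l \<in> S" "r \<in> S" "hi l + 1 = lo r" "l = b \<or> r = b" by blast
      note gl = good[OF lr(1), unfolded good_block_def]
      note gr = good[OF lr(2), unfolded good_block_def]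
      have ne: "l \<noteq> r" using lr gl gr by auto
      \<comment> \<open>One of the two blocks is at least 1 shorter than twice its weight, which
        pays for the connecting edge.\<close>
      let ?b = "Block (lo l) (hi r) (wt l + wt r) 0"
      show ?thesis
      proof (rule block_cover_merge[OF S h, of "{l, r}" ?b])
        show "good_block d ?b"
          using lr gl gr b debt[OF lr(1)] debt[OF lr(2)] unfolding good_block_def block.sel by (smt (verit))
        show "lo ?b \<le> lo x \<and> hi x \<le> hi ?b \<and> (lo ?b = 0 \<or> lo ?b - 3 * debt ?b \<le> lo x - 3 * debt x) \<and>
          (hi ?b = d \<or> hi x + 3 * debt x \<le> hi ?b + 3 * debt ?b)" if "x \<in> {l, r}" for x
        proof -
          from that have "x = l \<or> x = r" by blast
          then show ?thesis
            using lr(3) gl gr debt[OF lr(1)] debt[OF lr(2)] unfolding block.sel by (smt (verit))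
        qed
      qed (use lr ne in auto)
    qed
  qed
qed

text \<open>Each reduction lowers the number of blocks without raising the weight, so the hypothesis
  on \<open>d\<close> persists and the process ends.\<close>

lemma tight_block_partition:
  assumes "block_cover d h S" and h: "\<And>j. 0 \<le> j \<Longrightarrow> j \<le> d \<Longrightarrow> 0 \<le> h j \<and> h j \<le> j \<and> h j \<le> d - j"
    and "2 * sum wt S < d"
  shows "\<exists>S'. block_cover d h S' \<and> sum wt S' \<le> sum wt S \<and>
    (\<forall>b\<in>S'. debt b = 0 \<and> hi b - lo b = 2 * wt b \<and> (\<forall>c\<in>S'. b \<noteq> c \<longrightarrow> hi b < lo c \<or> hi c < lo b))"
  using assms(1,3)
proof (induction "card S" arbitrary: S rule: less_induct)
  case less
  show ?case
  proof (cases "\<forall>b\<in>S. debt b = 0 \<and> hi b - lo b = 2 * wt b \<and> (\<forall>c\<in>S. b \<noteq> c \<longrightarrow> hi b < lo c \<or> hi c < lo b)")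
    case False
    then obtain S' where S': "block_cover d h S'" "card S' < card S" "sum wt S' \<le> sum wt S"
      using block_cover_reduce[OF less.prems(1) h less.prems(2)] by blast
    with less.prems(2) have "2 * sum wt S' < d" by simp
    from less.hyps[OF S'(2,1) this] S'(3) show ?thesis by (meson order_trans)
  qed (use less.prems in blast)
qed

text \<open>A count of the \<open>d + 1\<close> integers in \<open>{0..d}\<close>: a tight block of
  weight \<open>w\<close> contains \<open>2 * w + 1\<close> of them.\<close>

lemma card_tight_partition:
  assumes S: "block_cover d h S" "0 \<le> d"
    and tight: "\<And>b. b \<in> S \<Longrightarrow> hi b - lo b = 2 * wt b"
    and disj: "\<And>b c. b \<in> S \<Longrightarrow> c \<in> S \<Longrightarrow> b \<noteq> c \<Longrightarrow> hi b < lo c \<or> hi c < lo b"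
  shows "d + 1 = 2 * sum wt S + int (card S)"
proof -
  have fin: "finite S" using S by (simp add: block_cover_def)
  have good: "good_block d b" if "b \<in> S" for b using S(1) that by (simp add: block_cover_def)
  have "{0..d} = (\<Union>b\<in>S. {lo b..hi b})"
  proof (intro equalityI subsetI)
    fix j assume "j \<in> {0..d}"
    then show "j \<in> (\<Union>b\<in>S. {lo b..hi b})" using S(1) unfolding block_cover_def by force
  next
    fix j assume "j \<in> (\<Union>b\<in>S. {lo b..hi b})"
    then obtain b where "b \<in> S" "lo b \<le> j" "j \<le> hi b" by auto
    then show "j \<in> {0..d}" using good[of b] by (simp add: good_block_def)
  qed
  moreover have "card (\<Union>b\<in>S. {lo b..hi b}) = (\<Sum>b\<in>S. card {lo b..hi b})"
    by (rule card_UN_disjoint) (use fin disj in \<open>auto simp: disjoint_iff, force\<close>)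
  ultimately have "card {0..d} = (\<Sum>b\<in>S. card {lo b..hi b})" by simp
  then have "int (card {0..d}) = (\<Sum>b\<in>S. int (card {lo b..hi b}))"
    by (simp only: of_nat_sum)
  then have "d + 1 = (\<Sum>b\<in>S. int (card {lo b..hi b}))" using S(2) by simp
  also have "\<dots> = (\<Sum>b\<in>S. 2 * wt b + 1)"
    using S(1) tight by (intro sum.cong) (auto simp: block_cover_def good_block_def)
  finally show ?thesis by (simp add: sum.distrib sum_distrib_left)
qed

section \<open>Split-sets as cuts of a diametrical path\<close>

context tree_diametrical_path
begin

lemma inj_on_cut: "I \<subseteq> {..<d} \<Longrightarrow> inj_on (\<lambda>i. {p i, p (Suc i)}) I"
  by (rule inj_onI) (use path_edge_eq in blast)

lemma walk_edges_P: "walk_edges P = cut {..<d}"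
  unfolding walk_edges_def length_P by auto

text \<open>The height bounds make each subpath diametrical: branches at \<open>i \<le> j\<close>
  contribute at most \<open>i - x\<close> and \<open>y - j\<close> to a distance, which together
  with \<open>j - i\<close> gives at most \<open>y - x\<close>.\<close>

lemma split_set_cutI:
  assumes I: "I \<subseteq> {..<d}" "I \<noteq> {}"
    and blocks: "\<And>j. j \<le> d \<Longrightarrow> \<exists>x y. is_block I x y \<and> x \<le> j \<and> j \<le> y \<and> even (y - x) \<and> x < y \<and>
      (\<forall>v\<in>slab x y. x + ht v \<le> proj v \<and> proj v + ht v \<le> y)"
  shows "split_set T (cut I)"
proof -
  have "even (walk_length (subpath_in P H)) \<and> 0 < walk_length (subpath_in P H) \<and>
      diametrical_path H (subpath_in P H)" if Hc: "H \<in> components (delete_edges T (cut I))" for H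
  proof -
    obtain v where v: "v \<in> V" "H = induced_subgraph (delete_edges T (cut I))
        {u. reachable (delete_edges T (cut I)) v u}"
      using Hc unfolding components_def verts_delete_edges by blast
    obtain x y where xy: "is_block I x y" "x \<le> proj v" "proj v \<le> y" "even (y - x)" "x < y"
      and ht: "\<forall>u\<in>slab x y. x + ht u \<le> proj u \<and> proj u + ht u \<le> y"
      using blocks[OF proj_le[of v]] by (elim exE conjE)
    have yd: "y \<le> d" using xy(1) by (simp add: is_block_def)
    have "v \<in> slab x y" using v xy by (simp add: slab_def)
    then have H: "H = induced_subgraph (delete_edges T (cut I)) (slab x y)"
      using component_eq_slab[OF I(1) xy(1)] v(2) by simp
    have pH: "p i \<in> slab x y" if "x \<le> i" "i \<le> y" for i
      using that yd by (simp add: slab_def proj_p p_verts)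
    have sub: "subpath_in P H = map p [x..<Suc y]"
      using subpath_slab[OF I(1) xy(1)] H by simp
    have shift: "map p [x..<Suc y] = map (\<lambda>i. p (x + i)) [0..<Suc (y - x)]"
      using xy(5) by (intro nth_equalityI) (simp_all add: Suc_diff_le del: upt_Suc)
    have "walk H (map p [x..<Suc y])"
      unfolding shift walk_map
    proof (intro conjI allI impI)
      show "p (x + 0) \<in> verts H" using pH[of x] xy(5) by (simp add: H induced_subgraph_def)
      fix i assume "i < y - x"
      then show "(p (x + i), p (x + Suc i)) \<in> adj H"
        using adj_slab[OF I(1) xy(1) p_adj[of "x + i"]] pH[of "x + i"] pH[of "Suc (x + i)"] yd
        by (simp add: H)
    qed
    moreover have "distinct (map p [x..<Suc y])"
      using p_inj yd by (simp add: distinct_map inj_on_def)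
    moreover have "walk_length (map p [x..<Suc y]) = y - x"
      using xy(5) by (simp add: walk_length_def del: upt_Suc)
    moreover have "diam H = y - x"
    proof (rule diam_eqI)
      have vH: "verts H = slab x y" by (simp add: H induced_subgraph_def)
      note dist = gdist_H[OF I(1) xy(1), folded H]
      show "finite (verts H)" using fin by (simp add: vH slab_def)
      show "p x \<in> verts H" "p y \<in> verts H" using pH xy(5) by (simp_all add: vH)
      show "gdist H (p x) (p y) = y - x"
        using dist[OF pH pH] gdist_p_right[of "p x" y] xy(5) yd by (simp add: p_verts proj_p ht_p)
      fix u w assume uw: "u \<in> verts H" "w \<in> verts H"
      then have "u \<in> slab x y" "w \<in> slab x y" by (simp_all add: vH)
      moreover from this have "u \<in> V" "w \<in> V" by (simp_all add: slab_def)
      ultimately show "gdist H u w \<le> y - x"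
        using gdist_proj_le[of u w] bspec[OF ht, of u] bspec[OF ht, of w] dist[of u w] by linarith
    qed
    ultimately show ?thesis using sub xy by (simp add: diametrical_path_def graph_path_def)
  qed
  moreover have "1 \<le> card (cut I)"
    using I card_image[OF inj_on_cut] finite_subset[OF I(1)] by (simp add: Suc_le_eq card_gt_0_iff)
  ultimately show ?thesis
    unfolding split_set_def using path image_mono[OF I(1)] walk_edges_P
    by (intro exI[of _ P] conjI ballI) simp_all
qed

text \<open>Conversely, the distances from a vertex to both ends of its subpath are at most the
  diameter of the component, which gives the height bounds.\<close>

lemma split_set_cutD:
  assumes M: "M \<subseteq> walk_edges P"
    and comp: "\<And>H. H \<in> components (delete_edges T M) \<Longrightarrow> even (walk_length (subpath_in P H)) \<and>
      0 < walk_length (subpath_in P H) \<and> diametrical_path H (subpath_in P H)"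
  obtains I where "I \<subseteq> {..<d}" "card I = card M"
    "\<And>x y. is_block I x y \<Longrightarrow> even (y - x) \<and> x < y"
    "\<And>x y v. is_block I x y \<Longrightarrow> v \<in> slab x y \<Longrightarrow> x + ht v \<le> proj v \<and> proj v + ht v \<le> y"
proof -
  obtain I where I: "I \<subseteq> {..<d}" "M = cut I" using M unfolding walk_edges_P subset_image_iff by blast
  have "even (y - x) \<and> x < y \<and> (\<forall>v\<in>slab x y. x + ht v \<le> proj v \<and> proj v + ht v \<le> y)"
    if b: "is_block I x y" for x y
  proof -
    have xy: "x \<le> y" "y \<le> d" using b by (auto simp: is_block_def)
    have pH: "p i \<in> slab x y" if "x \<le> i" "i \<le> y" for i
      using that xy by (simp add: slab_def proj_p p_verts)
    let ?H = "induced_subgraph (delete_edges T (cut I)) (slab x y)"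
    have "?H \<in> components (delete_edges T M)"
      unfolding components_def
      by (rule image_eqI[of _ _ "p x"])
        (use component_eq_slab[OF I(1) b pH[of x]] I(2) xy in \<open>simp_all add: p_verts\<close>)
    note H = comp[OF this, unfolded walk_length_slab[OF I(1) b]]
    then have diam: "diam ?H = y - x"
      by (simp add: diametrical_path_def walk_length_slab[OF I(1) b])
    have vH: "verts ?H = slab x y" by (simp add: induced_subgraph_def)
    then have "finite (verts ?H)" using fin by (simp add: slab_def)
    note le = gdist_le_diam[OF this, unfolded vH diam]
    have "x + ht v \<le> proj v \<and> proj v + ht v \<le> y" if v: "v \<in> slab x y" for v
    proof -
      have v': "v \<in> V" "x \<le> proj v" "proj v \<le> y" using v by (simp_all add: slab_def)
      have "ht v + (proj v - x) \<le> y - x" "ht v + (y - proj v) \<le> y - x"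
      using le[OF v pH[of x]] le[OF v pH[of y]] gdist_H[OF I(1) b v pH[of x]] 
        gdist_H[OF I(1) b v pH[of y]] gdist_p_left[of v x] gdist_p_right[of v y] v' xy
        by simp_all
      with v' show ?thesis by linarith
    qed
    with H show ?thesis by auto
  qed
  moreover have "card I = card M" using I card_image[OF inj_on_cut] by simp
  ultimately show thesis using that I(1) by blast
qed

end

lemma sorted_gaps:
  fixes I :: "nat set"
  assumes "finite I" "r < card I"
  shows "\<And>q. r < q \<Longrightarrow> q < card I \<Longrightarrow> sorted_list_of_set I ! r < sorted_list_of_set I ! q"
    and "sorted_list_of_set I ! r \<in> I"
proof -
  let ?l = "sorted_list_of_set I"
  have len: "length ?l = card I" by (simp add: assms)
  show "?l ! r < ?l ! q" if "r < q" "q < card I" for q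
    using sorted_wrt_nth_less[OF strict_sorted_list_of_set[of I]] that len by simp
  show "?l ! r \<in> I"
    using nth_mem[of r ?l] assms len by simp
qed

context tree_diametrical_path
begin

text \<open>The right ends \<open>t r\<close> are the cut indices in increasing order, followed by
  \<open>d\<close>; each further block starts right after the previous one.\<close>

lemma consecutive_blocks:
  assumes I: "I \<subseteq> {..<d}"
  obtains s t where "s 0 = 0" "\<And>r. s (Suc r) = Suc (t r)" "t (card I) = d"
    "\<And>r. r \<le> card I \<Longrightarrow> is_block I (s r) (t r)"
proof -
  let ?l = "sorted_list_of_set I" and ?m = "card I"
  have fin: "finite I" using I finite_subset by blast
  note less = sorted_gaps(1)[OF fin] and mem = sorted_gaps(2)[OF fin]
  define t where "t r = (if r < ?m then ?l ! r else d)" for r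
  define s where "s r = (if r = 0 then 0 else Suc (t (r - 1)))" for r
  have td: "t r \<le> d" for r using mem[of r] I by (fastforce simp: t_def)
  have t_less: "t q < t r" if "q < r" "r \<le> ?m" for q r
    using that less[of q r] mem[of q] I by (auto simp: t_def)
  have "is_block I (s r) (t r)" if r: "r \<le> ?m" for r
  proof -
    have "s r \<le> t r" using t_less[of "r - 1" r] r by (auto simp: s_def)
    moreover have "s r = 0 \<or> s r - 1 \<in> I" using mem[of "r - 1"] r by (auto simp: s_def t_def)
    moreover have "t r = d \<or> t r \<in> I" using mem[of r] by (auto simp: t_def)
    moreover have False if k: "k \<in> I" "s r \<le> k" "k < t r" for k
    proof -
      obtain q where q: "q < ?m" "k = t q"
        using k(1) fin by (metis t_def in_set_conv_nth set_sorted_list_of_set length_sorted_list_of_set)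
      have "\<not> r < q" "q \<noteq> r" using t_less[of r q] q k(3) by auto
      then have "q < r" by simp
      then have "q < r - 1 \<or> q = r - 1" by linarith
      then have "t q \<le> t (r - 1)" using t_less[of q "r - 1"] r by fastforce
      with \<open>q < r\<close> k(2) q show False by (simp add: s_def)
    qed
    ultimately show ?thesis using td[of r] unfolding is_block_def by auto
  qed
  then show thesis using that[of s t] by (simp add: s_def t_def)
qed

end

section \<open>The upper bound for bn-independent broadcasts\<close>

text \<open>A vertex hearing two broadcasters under \<open>f\<close> still hears both under the
  larger \<open>g\<close>, so it limits the values of \<open>g\<close>.\<close>

lemma bn_independent_mono:
  assumes "bn_independent G g" "\<And>v. v \<in> verts G \<Longrightarrow> f v \<le> g v" "x \<in> verts G"
    "hears G f x v" "hears G f x w" "v \<noteq> w" "u \<in> verts G" "0 < g u"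
  shows "g u \<le> gdist G x u"
proof -
  have "hears G g x v" "hears G g x w"
    using assms(2)[of v] assms(2)[of w] assms(4,5) by (auto simp: hears_def broadcasters_def)
  then show ?thesis using assms by (auto simp: bn_independent_def broadcasters_def)
qed

text \<open>A dominating bn-independent broadcast is maximal once each ball shares a vertex with another
  ball: a positive value cannot grow past the shared vertex, and a zero value cannot grow at all,
  since its vertex already hears the broadcast.\<close>

lemma maximal_bn_independentI:
  assumes bn: "bn_independent G f" and refl: "\<And>v. v \<in> verts G \<Longrightarrow> gdist G v v = 0"
    and dom: "\<And>v. v \<in> verts G \<Longrightarrow> \<exists>w. hears G f v w"
    and shared: "\<And>v. v \<in> broadcasters G f \<Longrightarrow> \<exists>x\<in>verts G. \<exists>w. w \<noteq> v \<and> hears G f x v \<and> hears G f x w"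
  shows "maximal_bn_independent G f"
  unfolding maximal_bn_independent_def
proof (intro conjI notI)
  assume "\<exists>g. bn_independent G g \<and> g \<noteq> f \<and> (\<forall>v\<in>verts G. f v \<le> g v)"
  then obtain g where g: "bn_independent G g" "g \<noteq> f" and le: "\<And>v. v \<in> verts G \<Longrightarrow> f v \<le> g v" by blast
  have "\<exists>v\<in>verts G. f v \<noteq> g v"
  proof (rule ccontr)
    assume "\<not> ?thesis"
    moreover have "f v = g v" if "v \<notin> verts G" for v
    proof -
      have "f v = undefined" using bn that
        by (auto simp: bn_independent_def broadcast_def PiE_def extensional_def split: if_splits)
      moreover have "g v = undefined" using g(1) that
        by (auto simp: bn_independent_def broadcast_def PiE_def extensional_def split: if_splits)
      ultimately show ?thesis by simp
    qed
    ultimately have "g = f" by (metis ext)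
    with g show False by simp
  qed
  then obtain v where v: "v \<in> verts G" "f v < g v" using le by (metis le_neq_implies_less)
  show False
  proof (cases "f v = 0")
    case True
    obtain w where w: "hears G f v w" using dom v by blast
    then have wf: "w \<in> verts G" "0 < f w" "gdist G v w \<le> f w" by (auto simp: hears_def broadcasters_def)
    then have "w \<noteq> v" using True by auto
    moreover have "hears G g v w" "hears G g v v"
      using wf le[OF wf(1)] v refl by (auto simp: hears_def broadcasters_def)
    ultimately have "g v \<le> gdist G v v"
      using bn_independent_mono[OF g(1) order_refl v(1), of w v v] v by simp
    then show False using refl v by simp
  next
    case False
    then obtain x w where xw: "x \<in> verts G" "w \<noteq> v" "hears G f x v" "hears G f x w"
      using shared[of v] v by (auto simp: broadcasters_def)
    then have "g v \<le> gdist G x v"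
      using bn_independent_mono[OF g(1) le xw(1) xw(3,4)] v by auto
    then show False using v xw(3) by (simp add: hears_def)
  qed
qed (rule bn)

section \<open>The broadcast on the centres of the blocks\<close>

context tree_diametrical_path
begin

text \<open>The \<open>m + 1\<close> blocks from \<open>s r\<close> to \<open>t r\<close> tile the
  path, and \<open>R\<close> collects the blocks whose radius is raised by one: no two neighbours
  are raised, but each block has a neighbour such that one of the two is raised.\<close>

context
  fixes m :: nat and s t :: "nat \<Rightarrow> nat" and R :: "nat set"
  assumes m: "1 \<le> m" and s0: "s 0 = 0" and sSuc: "\<And>r. s (Suc r) = Suc (t r)" and tm: "t m = d"
    and even_block: "\<And>r. r \<le> m \<Longrightarrow> even (t r - s r) \<and> s r < t r"
    and ht_block: "\<And>r v. r \<le> m \<Longrightarrow> v \<in> slab (s r) (t r) \<Longrightarrow> s r + ht v \<le> proj v \<and> proj v + ht v \<le> t r"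
    and R_sub: "R \<subseteq> {..m}"
    and R_sparse: "\<And>r. r \<in> R \<Longrightarrow> Suc r \<notin> R"
    and R_dom: "\<And>r. r \<le> m \<Longrightarrow> \<exists>q\<le>m. (q = Suc r \<or> r = Suc q) \<and> (r \<in> R \<or> q \<in> R)"
begin

definition radius where "radius r = (t r - s r) div 2"
definition centre where "centre r = s r + radius r"
definition blk where "blk v = (LEAST r. proj v \<le> t r)"
definition val where "val r = radius r + of_bool (r \<in> R)"
text \<open>Comparing \<open>v\<close> with the centre of its own block avoids a search for the
  index; \<open>undefined\<close> outside \<open>V\<close> makes the function extensional.\<close>

definition bc where "bc v = (if v \<in> V then if v = p (centre (blk v)) then val (blk v) else 0 else undefined)"

lemma radius: "r \<le> m \<Longrightarrow> 1 \<le> radius r \<and> centre r = s r + radius r \<and> t r = centre r + radius r"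
  using even_block[of r] unfolding centre_def radius_def
  by (auto elim!: evenE simp: algebra_simps) presburger+

lemma t_less_s: "r < q \<Longrightarrow> q \<le> m \<Longrightarrow> t r < s q"
proof (induction q)
  case (Suc q)
  then show ?case using even_block[of q] by (cases "r = q") (auto simp: sSuc)
qed simp

lemma t_le: "r \<le> m \<Longrightarrow> t r \<le> d"
  using t_less_s[of r m] even_block[of m] tm by (cases "r = m") auto

lemma centre_le: "r \<le> m \<Longrightarrow> centre r \<le> d"
  using radius[of r] t_le[of r] by simp

lemma blk_le: "blk v \<le> m"
  unfolding blk_def by (rule Least_le) (simp add: tm proj_le)

lemma blk_bounds: "s (blk v) \<le> proj v \<and> proj v \<le> t (blk v)"
proof
  show "proj v \<le> t (blk v)"
    unfolding blk_def by (rule LeastI[of _ m]) (simp add: tm proj_le)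
  show "s (blk v) \<le> proj v"
  proof (cases "blk v")
    case (Suc r)
    then have "\<not> proj v \<le> t r" using not_less_Least[of r "\<lambda>r. proj v \<le> t r"] by (simp add: blk_def)
    then show ?thesis by (simp add: Suc sSuc)
  qed (simp add: s0)
qed

lemma blk_eqI: "r \<le> m \<Longrightarrow> s r \<le> proj v \<Longrightarrow> proj v \<le> t r \<Longrightarrow> blk v = r"
  using t_less_s[of r "blk v"] t_less_s[of "blk v" r] blk_le[of v] blk_bounds[of v]
  by (cases r "blk v" rule: linorder_cases) auto

lemma blk_p: "r \<le> m \<Longrightarrow> s r \<le> i \<Longrightarrow> i \<le> t r \<Longrightarrow> blk (p i) = r"
  using blk_eqI[of r "p i"] proj_p[of i] t_le[of r] by simp

lemma blk_centre: "r \<le> m \<Longrightarrow> blk (p (centre r)) = r"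
  using blk_p radius[of r] by simp

lemma bc_centre: "r \<le> m \<Longrightarrow> bc (p (centre r)) = val r"
  using p_verts centre_le by (simp add: bc_def blk_centre)

lemma val_pos: "r \<le> m \<Longrightarrow> 0 < val r"
  using radius[of r] by (simp add: val_def)

lemma broadcasters_bc: "broadcasters T bc = (\<lambda>r. p (centre r)) ` {..m}"
proof (intro equalityI subsetI)
  fix v assume "v \<in> broadcasters T bc"
  then have "v = p (centre (blk v))" by (auto simp: broadcasters_def bc_def split: if_splits)
  then show "v \<in> (\<lambda>r. p (centre r)) ` {..m}" using blk_le[of v] by blast
next
  fix v assume "v \<in> (\<lambda>r. p (centre r)) ` {..m}"
  then show "v \<in> broadcasters T bc"
    using val_pos p_verts centre_le by (auto simp: broadcasters_def bc_centre)
qed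

text \<open>The height bounds put the whole slab into the ball of radius \<open>radius\<close>
  around the centre.\<close>

lemma dist_own: 
  assumes "v \<in> V" shows "gdist T v (p (centre (blk v))) \<le> radius (blk v)"
proof -
  have "s (blk v) + ht v \<le> proj v \<and> proj v + ht v \<le> t (blk v)"
    using ht_block[OF blk_le[of v], of v] blk_bounds[of v] assms by (simp add: slab_def)
  then show ?thesis
    using gdist_p[OF assms centre_le[OF blk_le[of v]]] radius[OF blk_le[of v]] by linarith
qed

text \<open>A vertex of another block is farther than \<open>radius q\<close> from the centre of
  \<open>q\<close>. If it is farther by only 1, it is the path vertex at the near end of an adjacent
  block, at full radius from its own centre.\<close>

lemma dist_other:
  assumes v: "v \<in> V" and q: "q \<le> m" "q \<noteq> blk v"
  shows "radius q < gdist T v (p (centre q))"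
    and "gdist T v (p (centre q)) \<le> Suc (radius q) \<Longrightarrow>
      (q = Suc (blk v) \<or> blk v = Suc q) \<and> radius (blk v) \<le> gdist T v (p (centre (blk v)))"
proof -
  let ?r = "blk v"
  note b = blk_bounds[of v] and r = blk_le[of v]
  note dist = gdist_p[OF v centre_le[OF q(1)]] gdist_p[OF v centre_le[OF r]]
  note rad = radius[OF q(1)] radius[OF r]
  have "radius q < gdist T v (p (centre q)) \<and> (gdist T v (p (centre q)) \<le> Suc (radius q) \<longrightarrow>
      (q = Suc ?r \<or> ?r = Suc q) \<and> radius ?r \<le> gdist T v (p (centre ?r)))"
  proof (cases "q < ?r")
    case True
    have "t q < s ?r" using t_less_s[OF True r] .
    moreover have "?r = Suc q \<or> Suc (t q) < s ?r"
    proof (cases "?r = Suc q")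
      case False
      then have "t (Suc q) < s ?r" using t_less_s[of "Suc q" ?r] True r by simp
      then show ?thesis using even_block[of "Suc q"] True r by (simp add: sSuc)
    qed simp
    ultimately show ?thesis using dist rad b by linarith
  next
    case False
    then have lt: "?r < q" using q by simp
    have "t ?r < s q" using t_less_s[OF lt q(1)] .
    moreover have "q = Suc ?r \<or> Suc (t ?r) < s q"
    proof (cases "q = Suc ?r")
      case False
      then have "t (Suc ?r) < s q" using t_less_s[of "Suc ?r" q] lt q by simp
      then show ?thesis using even_block[of "Suc ?r"] lt q by (simp add: sSuc)
    qed simp
    ultimately show ?thesis using dist rad b by linarith
  qed
  then show "radius q < gdist T v (p (centre q))" 
    "gdist T v (p (centre q)) \<le> Suc (radius q) \<Longrightarrow>
      (q = Suc ?r \<or> ?r = Suc q) \<and> radius ?r \<le> gdist T v (p (centre ?r))" by auto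
qed

lemma card_V: "card V \<noteq> 1"
proof
  assume "card V = 1"
  then have "p 0 = p d" using p_verts[of 0] p_verts[of d] by (metis card_1_singletonE le_refl singletonD zero_le)
  then have "d = 0" using p_inj[of 0 d] by simp
  then show False using even_block[of m] tm by simp
qed

text \<open>As \<open>m \<ge> 1\<close>, another block lies beyond one end of block
  \<open>r\<close>, so an end of the path has distance at least \<open>radius r + 1\<close> from the
  centre.\<close>

lemma val_le_ecc: assumes r: "r \<le> m" shows "val r \<le> ecc T (p (centre r))"
proof -
  let ?c = "p (centre r)"
  have c: "?c \<in> V" "proj ?c = centre r" "ht ?c = 0"
    using p_verts proj_p ht_p centre_le[OF r] by auto
  have far: "i \<le> d \<Longrightarrow> \<bar>int i - int (centre r)\<bar> \<le> int (ecc T ?c)" for i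
    using gdist_le_ecc[OF fin p_verts[of i], of ?c] gdist_p[OF c(1), of i] c by simp
  have "val r \<le> Suc (radius r)" by (simp add: val_def)
  moreover have "Suc (radius r) \<le> ecc T ?c"
  proof (cases "r = 0")
    case True
    then have "t r < d" using t_less_s[of 0 m] even_block[of m] tm m by simp
    then show ?thesis using far[of d] radius[OF r] by simp
  next
    case False
    then have "0 < s r" using sSuc[of "r - 1"] by simp
    then show ?thesis using far[of 0] radius[OF r] by simp
  qed
  ultimately show ?thesis by simp
qed

lemma broadcast_bc: "broadcast T bc"
proof -
  have le: "bc v \<le> ecc T v" if "v \<in> V" for v
    using val_le_ecc[OF blk_le, of v] that by (auto simp: bc_def)
  then have "bc \<in> V \<rightarrow>\<^sub>E {0..d}"
    using order_trans[OF le ecc_le_diam[OF fin]] by (auto simp: bc_def)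
  with le card_V show ?thesis by (simp add: broadcast_def)
qed

lemma hears_bc: "hears T bc x v \<longleftrightarrow> (\<exists>r\<le>m. v = p (centre r) \<and> gdist T x v \<le> val r)"
  by (auto simp: hears_def broadcasters_bc bc_centre)

text \<open>If \<open>x\<close> hears two centres, one of them belongs to another block
  \<open>q\<close>, which must be raised. Then \<open>x\<close> is on the boundary of the ball of
  its own block, which is not raised because its neighbour \<open>q\<close> is; no other ball has
  \<open>x\<close> in its interior.\<close>

lemma bn_independent_bc: "bn_independent T bc"
  unfolding bn_independent_def
proof (intro conjI ballI impI)
  fix x u
  assume x: "x \<in> V" and two: "\<exists>v w. v \<noteq> w \<and> hears T bc x v \<and> hears T bc x w"
    and "u \<in> broadcasters T bc"
  then obtain k where k: "k \<le> m" "u = p (centre k)" by (auto simp: broadcasters_bc)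
  obtain q where q: "q \<le> m" "q \<noteq> blk x" "gdist T x (p (centre q)) \<le> val q"
    using two unfolding hears_bc by metis
  have "q \<in> R" using dist_other(1)[OF x q(1,2)] q(3) by (cases "q \<in> R") (auto simp: val_def)
  then have "(q = Suc (blk x) \<or> blk x = Suc q) \<and> radius (blk x) \<le> gdist T x (p (centre (blk x)))"
    using dist_other(2)[OF x q(1,2)] q(3) by (simp add: val_def)
  moreover from this \<open>q \<in> R\<close> have "blk x \<notin> R" using R_sparse by metis
  ultimately have own: "val (blk x) \<le> gdist T x (p (centre (blk x)))" by (simp add: val_def)
  have "val k \<le> gdist T x (p (centre k))"
  proof (cases "k = blk x")
    case False
    then show ?thesis using dist_other(1)[OF x k(1) False] by (simp add: val_def)
  qed (use own in simp)
  then show "bc u \<le> gdist T x u" using k bc_centre by simp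
qed (rule broadcast_bc)

lemma centre_inj: "r \<le> m \<Longrightarrow> q \<le> m \<Longrightarrow> p (centre r) = p (centre q) \<longleftrightarrow> r = q"
  using blk_centre by metis

lemma hears_centre:
  "r \<le> m \<Longrightarrow> hears T bc x (p (centre r)) \<longleftrightarrow> gdist T x (p (centre r)) \<le> val r"
  unfolding hears_bc using centre_inj by blast

lemma shared_vertex:
  assumes "r < m" "r \<in> R \<or> Suc r \<in> R"
  shows "\<exists>x\<in>V. hears T bc x (p (centre r)) \<and> hears T bc x (p (centre (Suc r)))"
proof -
  \<comment> \<open>The raised ball takes in the near end of the other block: the first vertex of
    block \<open>Suc r\<close> if \<open>r\<close> is raised, otherwise the last vertex of block
    \<open>r\<close>.\<close>
  define i where "i = (if r \<in> R then s (Suc r) else t r)"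
  have rm: "r \<le> m" "Suc r \<le> m" using assms by auto
  have i: "i \<le> d" using radius[OF rm(2)] t_le[OF rm(1)] t_le[OF rm(2)] by (simp add: i_def)
  have v: "i = s (Suc r) \<and> val r = Suc (radius r) \<and> radius (Suc r) \<le> val (Suc r) \<or>
      i = t r \<and> val r = radius r \<and> val (Suc r) = Suc (radius (Suc r))"
    using assms(2) by (cases "r \<in> R") (auto simp: i_def val_def)
  note D = gdist_p[OF p_verts[OF i] centre_le[OF rm(1)], unfolded proj_p[OF i] ht_p[OF i]]
    gdist_p[OF p_verts[OF i] centre_le[OF rm(2)], unfolded proj_p[OF i] ht_p[OF i]]
  have "gdist T (p i) (p (centre r)) \<le> val r" "gdist T (p i) (p (centre (Suc r))) \<le> val (Suc r)"
    using D radius[OF rm(1)] radius[OF rm(2)] sSuc[of r] v by linarith+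
  then show ?thesis using p_verts[OF i] hears_centre rm by blast
qed

lemma maximal_bc: "maximal_bn_independent T bc"
proof (rule maximal_bn_independentI[OF bn_independent_bc gdist_self])
  show "\<exists>w. hears T bc v w" if "v \<in> V" for v
    using dist_own[OF that] blk_le[of v] unfolding hears_bc val_def
    by (intro exI[of _ "p (centre (blk v))"] exI[of _ "blk v"]) simp
  fix v assume "v \<in> broadcasters T bc"
  then obtain r where r: "r \<le> m" "v = p (centre r)" by (auto simp: broadcasters_bc)
  obtain q where q: "q \<le> m" "q = Suc r \<or> r = Suc q" "r \<in> R \<or> q \<in> R" using R_dom[OF r(1)] by blast
  have "\<exists>x\<in>V. hears T bc x (p (centre r)) \<and> hears T bc x (p (centre q))"
    using shared_vertex[of r] shared_vertex[of q] r(1) q by auto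
  moreover have "p (centre q) \<noteq> v" using centre_inj r q by auto
  ultimately show "\<exists>x\<in>V. \<exists>w. w \<noteq> v \<and> hears T bc x v \<and> hears T bc x w" using r(2) by metis
qed

lemma sum_radius: "k \<le> m \<Longrightarrow> (\<Sum>r\<le>k. 2 * radius r + 1) = t k + 1"
  by (induction k) (use radius s0 sSuc in auto)

text \<open>The blocks have \<open>2 * radius r + 1\<close> path vertices each and
  \<open>d + 1\<close> together, so the radii add up to half of \<open>d - m\<close>.\<close>

lemma cost_bc: "2 * cost T bc + m = d + 2 * card R"
proof -
  have "cost T bc = (\<Sum>v\<in>(\<lambda>r. p (centre r)) ` {..m}. bc v)"
    unfolding cost_def broadcasters_bc[symmetric]
    by (rule sum.mono_neutral_right) (auto simp: broadcasters_def fin)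
  also have "\<dots> = (\<Sum>r\<le>m. val r)"
    by (subst sum.reindex) (auto simp: inj_on_def centre_inj bc_centre)
  also have "\<dots> = (\<Sum>r\<le>m. radius r) + card R"
    using R_sub by (simp add: val_def sum.distrib sum_of_bool_eq Int_absorb1)
  finally have "2 * cost T bc + (m + 1) = (\<Sum>r\<le>m. 2 * radius r + 1) + 2 * card R"
    by (simp only: sum.distrib sum_distrib_left[symmetric]) simp
  then show ?thesis using sum_radius[of m] tm by simp
qed

end

lemma i_bn_le_blocks:
  fixes m :: nat and s t :: "nat \<Rightarrow> nat"
  assumes m: "1 \<le> m" and "s 0 = 0" "\<And>r. s (Suc r) = Suc (t r)" "t m = d"
    and "\<And>r. r \<le> m \<Longrightarrow> even (t r - s r) \<and> s r < t r"
    and "\<And>r v. r \<le> m \<Longrightarrow> v \<in> slab (s r) (t r) \<Longrightarrow> s r + ht v \<le> proj v \<and> proj v + ht v \<le> t r"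
  shows "2 * i_bn T + m \<le> d + 2 * (m div 3 + 1)"
proof -
  \<comment> \<open>Every third block, from index 1 on, serves itself and its neighbours. If 3
    divides \<open>m\<close>, the last block has no such neighbour and is raised itself; block
    \<open>m - 1\<close> has residue 2, so sparseness is kept.\<close>
  define R where "R = {r. r \<le> m \<and> (r mod 3 = 1 \<or> r = m \<and> m mod 3 = 0)}"
  have sub: "R \<subseteq> {..m}" by (auto simp: R_def)
  have sparse: "Suc r \<notin> R" if "r \<in> R" for r
    using that unfolding R_def mem_Collect_eq by presburger
  have dom: "\<exists>q\<le>m. (q = Suc r \<or> r = Suc q) \<and> (r \<in> R \<or> q \<in> R)" if rm: "r \<le> m" for r
  proof -
    have "r mod 3 = 0 \<or> r mod 3 = 1 \<or> r mod 3 = 2" by presburger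
    then consider "r = m" "r \<in> R" | "r < m" "r mod 3 = 0" | "r < m" "r \<in> R" | "r mod 3 = 2"
      using rm le_neq_implies_less[OF rm] unfolding R_def mem_Collect_eq by metis
    then show ?thesis
    proof cases
      case 1
      then show ?thesis using m by (intro exI[of _ "m - 1"]) auto
    next
      case 2
      then have "Suc r \<in> R" by (auto simp: R_def mod_Suc)
      then show ?thesis using 2 by (intro exI[of _ "Suc r"]) auto
    next
      case 3
      then show ?thesis by (intro exI[of _ "Suc r"]) auto
    next
      case 4
      then obtain q where q: "r = Suc q" by (cases r) auto
      with 4 have "q mod 3 = 1" by presburger
      then have "q \<in> R" using q rm by (simp add: R_def)
      then show ?thesis using q rm by (intro exI[of _ q]) auto
    qed
  qed
  \<comment> \<open>An index of residue 0 in \<open>R\<close> is \<open>m\<close>, and an index of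
    residue 1 with the same quotient would exceed it.\<close>
  have "inj_on (\<lambda>r. r div 3) R"
  proof (rule inj_onI)
    fix r q assume "r \<in> R" "q \<in> R" and eq: "r div 3 = q div 3"
    then have "r \<le> m" "q \<le> m" "r mod 3 = 1 \<or> r = m \<and> r mod 3 = 0" "q mod 3 = 1 \<or> q = m \<and> q mod 3 = 0"
      by (auto simp: R_def)
    moreover have "r = 3 * (r div 3) + r mod 3" by simp
    moreover have "q = 3 * (r div 3) + q mod 3" by (simp add: eq)
    ultimately show "r = q" by linarith
  qed
  moreover have "(\<lambda>r. r div 3) ` R \<subseteq> {..m div 3}" by (auto simp: R_def div_le_mono)
  ultimately have "card R \<le> m div 3 + 1" using card_inj_on_le[of _ R "{..m div 3}"] by simp
  note block = assms sub sparse dom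
  have "i_bn T \<le> cost T (bc s t R)"
    unfolding i_bn_def by (rule Least_le) (use maximal_bc[OF block] in blast)
  with cost_bc[OF block] \<open>card R \<le> m div 3 + 1\<close> show ?thesis by simp
qed

end

section \<open>The lower bound for the broadcast number\<close>

lemma card_le_spread:
  fixes B :: "nat set"
  assumes "finite B" "\<And>k l. k \<in> B \<Longrightarrow> l \<in> B \<Longrightarrow> k \<le> l \<Longrightarrow> l - k \<le> c"
  shows "card B \<le> c + 1"
proof (cases "B = {}")
  case False
  have "B \<subseteq> {Min B..Min B + c}"
  proof
    fix l assume l: "l \<in> B"
    have "Min B \<in> B" "Min B \<le> l" using assms(1) False l by simp_all
    then show "l \<in> {Min B..Min B + c}" using assms(2)[of "Min B" l] l by simp
  qed
  then show ?thesis using card_mono[of "{Min B..Min B + c}" B] by simp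
qed simp

section \<open>Branch heights and the traces of balls on the path\<close>

context tree_diametrical_path
begin

definition height where "height j = Max (ht ` {v \<in> V. proj v = j})"

lemma ht_le_height: "v \<in> V \<Longrightarrow> ht v \<le> height (proj v)"
  unfolding height_def using fin by (intro Max_ge) auto

lemma height_attained: 
  assumes "j \<le> d" obtains v where "v \<in> V" "proj v = j" "ht v = height j"
proof -
  have "ht ` {v \<in> V. proj v = j} \<noteq> {}" using p_verts proj_p assms by auto
  then have "height j \<in> ht ` {v \<in> V. proj v = j}"
    unfolding height_def using fin by (intro Max_in) auto
  then show thesis using that by auto
qed

lemma height_le: "j \<le> d \<Longrightarrow> height j \<le> j \<and> height j + j \<le> d"
  using height_attained[of j] ht_le by metis

context
  fixes f :: "'a \<Rightarrow> nat"
  assumes dom: "\<And>u. u \<in> V \<Longrightarrow> \<exists>v. hears T f u v"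
begin

text \<open>The broadcasters whose balls meet the path, as \<open>ht v\<close> is the distance from
  \<open>v\<close> to it; a ball of a vertex in \<open>far\<close> stays inside one branch.\<close>

definition near where "near = {v \<in> broadcasters T f. ht v \<le> f v}"
definition far where "far = {v \<in> broadcasters T f. f v < ht v}"

lemma near_far: "finite near" "finite far" "near \<union> far = broadcasters T f" "near \<inter> far = {}"
  using fin by (auto simp: near_def far_def broadcasters_def)

definition far_cost where "far_cost j = sum f {w \<in> far. proj w = j}"

text \<open>The ball of \<open>v\<close> contains \<open>p j\<close> and, together with the far
  balls of the branch at \<open>j\<close>, accounts for the height of that branch. From inside the
  branch it can reach height \<open>f v + ht v\<close>; from elsewhere it first spends its strength
  on the way to \<open>p j\<close>.\<close>

definition covers where
  "covers j v \<longleftrightarrow> v \<in> near \<and> \<bar>int j - int (proj v)\<bar> + int (ht v) \<le> int (f v) \<and>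
    int (height j) \<le> int (f v) + 3 * int (far_cost j) +
      (if proj v = j then int (ht v) else - int (ht v) - \<bar>int j - int (proj v)\<bar>)"

text \<open>Only a broadcast vertex of the branch at \<open>j\<close> can cover part of that branch without covering
  the path vertex \<open>j\<close>, and it covers at most \<open>2 * f w + 1 \<le> 3 * f w\<close> vertices of a longest leg of
  the branch. The rest of the leg is covered by broadcast vertices whose ball meets the path.\<close>

lemma height_covered:
  assumes j: "j \<le> d"
  shows "\<exists>v. covers j v"
proof -
  obtain z where z: "z \<in> V" "proj z = j" "ht z = height j" using height_attained[OF j] .
  let ?n = "height j"
  have pj: "p j \<in> V" using p_verts[OF j] .
  have n: "gdist T (p j) z = ?n" using gdist_commute[OF conn pj z(1)] z by (simp add: ht_def)
  \<comment> \<open>\<open>g\<close> runs up a longest leg of the branch, so \<open>g k\<close> has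
    height \<open>k\<close>.\<close>
  obtain g where g: "g 0 = p j" "g ?n = z"
    "\<And>k l. k \<le> l \<Longrightarrow> l \<le> ?n \<Longrightarrow> gdist T (g k) (g l) = l - k"
    "\<And>k. k \<le> ?n \<Longrightarrow> g k \<in> V"
    using gdist_geodesic[OF connected_reachable[OF conn pj z(1)]] unfolding n by metis
  have proj_g: "proj (g k) = j" if "k \<le> ?n" for k
    using proj_convex[OF pj z(1) g(4)[OF that], of j j] g(3)[of 0 k] g(3)[of k ?n] that g(1,2) n z(2)
      proj_p[OF j] by simp
  have ht_g: "ht (g k) = k" if "k \<le> ?n" for k
    using gdist_commute[OF conn pj g(4)[OF that]] g(3)[of 0 k] proj_g[OF that] that g(1)
    by (simp add: ht_def)
  have dist_g: "int (gdist T (g k) v) = int k + int (ht v) + \<bar>int j - int (proj v)\<bar>"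
    if "k \<le> ?n" "v \<in> V" "proj v \<noteq> j" for k v
    using gdist_proj_neq[OF g(4)[OF that(1)] that(2)] proj_g[OF that(1)] ht_g[OF that(1)] that(3)
    by simp
  define A where "A = {k. k \<le> ?n \<and> (\<exists>v\<in>near. gdist T (g k) v \<le> f v)}"
  have finA: "finite A" by (simp add: A_def)
  have "0 \<in> A"
  proof -
    obtain v where v: "v \<in> broadcasters T f" "gdist T (p j) v \<le> f v"
      using dom[OF pj] by (auto simp: hears_def)
    have vV: "v \<in> V" using v by (simp add: broadcasters_def)
    have "int (gdist T (p j) v) = int (ht v) + \<bar>int j - int (proj v)\<bar>"
      using gdist_p[OF vV j] gdist_commute[OF conn vV pj] by simp
    then have "ht v \<le> f v" using v(2) by simp
    with v have "v \<in> near" by (simp add: near_def)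
    with v(2) show ?thesis using g(1) by (auto simp: A_def)
  qed
  \<comment> \<open>The highest level heard from a near vertex; above it only far vertices are
    heard.\<close>
  define K where "K = Max A"
  have "K \<in> A" using Max_in[OF finA] \<open>0 \<in> A\<close> by (auto simp: K_def)
  then obtain v where v: "K \<le> ?n" "v \<in> near" "gdist T (g K) v \<le> f v" by (auto simp: A_def)
  have vV: "v \<in> V" using v(2) by (simp add: near_def broadcasters_def)
  let ?N = "{w \<in> far. proj w = j}"
  define B where "B w = {k. k \<le> ?n \<and> gdist T (g k) w \<le> f w}" for w
  have finN: "finite ?N" using near_far by simp
  have "{K<..?n} \<subseteq> (\<Union>w\<in>?N. B w)"
  proof
    fix k assume k: "k \<in> {K<..?n}"
    then obtain w where w: "w \<in> broadcasters T f" "gdist T (g k) w \<le> f w"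
      using dom[OF g(4)] by (auto simp: hears_def)
    have wV: "w \<in> V" using w by (simp add: broadcasters_def)
    have "k \<notin> A" using Max_ge[OF finA] k by (fastforce simp: K_def)
    then have "w \<notin> near" using k w(2) by (auto simp: A_def)
    then have wf: "w \<in> far" using w near_far(3) by blast
    then have "f w < ht w" by (simp add: far_def)
    \<comment> \<open>From another branch, \<open>w\<close> would have distance at least
      \<open>ht w\<close> to the leg, which exceeds \<open>f w\<close>.\<close>
    then have "proj w = j" using dist_g[of k w] k wV w(2) by fastforce
    with wf k w(2) show "k \<in> (\<Union>w\<in>?N. B w)" by (auto simp: B_def)
  qed
  then have "card {K<..?n} \<le> card (\<Union>w\<in>?N. B w)"
    using finN by (intro card_mono) (auto simp: B_def)
  also have "\<dots> \<le> (\<Sum>w\<in>?N. card (B w))" by (rule card_UN_le[OF finN])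
  also have "\<dots> \<le> (\<Sum>w\<in>?N. 3 * f w)"
  proof (rule sum_mono)
    fix w assume "w \<in> ?N"
    then have w: "w \<in> V" "0 < f w" by (auto simp: far_def broadcasters_def)
    have "card (B w) \<le> 2 * f w + 1"
    proof (rule card_le_spread)
      fix k l assume kl: "k \<in> B w" "l \<in> B w" "k \<le> l"
      then have "gdist T (g k) (g l) \<le> gdist T (g k) w + gdist T w (g l)"
        "gdist T w (g l) = gdist T (g l) w"
        using gdist_triangle[OF conn g(4) w(1) g(4)] gdist_commute[OF conn w(1) g(4)]
        by (auto simp: B_def)
      then show "l - k \<le> 2 * f w" using g(3)[of k l] kl by (simp add: B_def)
    qed (simp add: B_def)
    then show "card (B w) \<le> 3 * f w" using w(2) by simp
  qed
  also have "\<dots> = 3 * far_cost j" by (simp add: far_cost_def sum_distrib_left)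
  finally have "?n \<le> K + 3 * far_cost j" by simp
  then have len: "int ?n \<le> int K + 3 * int (far_cost j)" by linarith
  show ?thesis
  proof (cases "proj v = j")
    case True
    have "gdist T (g K) (p j) \<le> gdist T (g K) v + gdist T v (p j)"
      using gdist_triangle[OF conn g(4)[OF v(1)] vV pj] .
    moreover have "gdist T (g K) (p j) = K" using ht_g[OF v(1)] proj_g[OF v(1)] by (simp add: ht_def)
    moreover have "gdist T v (p j) = ht v" using True by (simp add: ht_def)
    moreover have "ht v \<le> f v" using v(2) by (simp add: near_def)
    ultimately have "covers j v" using v(2,3) len True unfolding covers_def by simp
    then show ?thesis ..
  next
    case False
    then have "covers j v" using dist_g[OF v(1) vV False] v(2,3) len unfolding covers_def by simp
    then show ?thesis ..
  qed
qed

text \<open>Each near ball leaves a block on the path. The cost of the far balls in the branch at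
  \<open>j\<close> is charged to the one near vertex chosen to cover \<open>j\<close>, so its block
  can carry that branch as debt.\<close>

lemma block_cover_of_dominating:
  "\<exists>S. block_cover (int d) (\<lambda>j. int (height (nat j))) S \<and> sum wt S \<le> int (cost T f)"
proof -
  obtain \<alpha> where \<alpha>: "\<forall>j\<in>{..d}. covers j (\<alpha> j)"
    using bchoice[of "{..d}" covers] height_covered by auto
  define g where "g v = sum f {w \<in> far. \<alpha> (proj w) = v}" for v
  \<comment> \<open>The trace has radius \<open>f v - ht v\<close> and is truncated at the ends of
    the path. Without truncation, its length plus twice the debt is exactly twice the
    weight.\<close>
  define b where "b v = Block (max 0 (int (proj v) - (int (f v) - int (ht v))))
     (min (int d) (int (proj v) + (int (f v) - int (ht v))))
     (int (f v) + int (g v)) (int (ht v) + int (g v))" for v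
  have near: "0 < f v" "ht v \<le> f v" if "v \<in> near" for v
    using that by (auto simp: near_def broadcasters_def)
  have good: "good_block (int d) (b v)" if "v \<in> near" for v
    using near[OF that] proj_le[of v] unfolding good_block_def b_def block.sel by auto
  have cover: "\<exists>c\<in>b ` near. lo c \<le> i \<and> i \<le> hi c \<and> lo c - 3 * debt c \<le> i - int (height (nat i)) \<and>
      i + int (height (nat i)) \<le> hi c + 3 * debt c" if "i \<in> {0..int d}" for i
  proof -
    have "i = int (nat i)" "nat i \<le> d" using that by auto
    then obtain j where j: "i = int j" "j \<le> d" by blast
    have a: "covers j (\<alpha> j)" using \<alpha> j(2) by simp
    have "far_cost j \<le> g (\<alpha> j)"
      unfolding g_def far_cost_def using near_far by (intro sum_mono2) auto
    then have "lo (b (\<alpha> j)) \<le> int j \<and> int j \<le> hi (b (\<alpha> j)) \<and>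
        lo (b (\<alpha> j)) - 3 * debt (b (\<alpha> j)) \<le> int j - int (height j) \<and>
        int j + int (height j) \<le> hi (b (\<alpha> j)) + 3 * debt (b (\<alpha> j))"
      using a height_le[OF j(2)] j(2) unfolding b_def block.sel covers_def by (auto split: if_splits)
    moreover have "b (\<alpha> j) \<in> b ` near" using a by (simp add: covers_def)
    ultimately show ?thesis unfolding j(1) nat_int by blast
  qed
  have "block_cover (int d) (\<lambda>j. int (height (nat j))) (b ` near)"
    unfolding block_cover_def using near_far(1) good cover by blast
  moreover have "sum wt (b ` near) \<le> int (cost T f)"
  proof -
    \<comment> \<open>Different near vertices may give the same block, hence only an
      inequality.\<close>
    have "sum wt (b ` near) \<le> (\<Sum>v\<in>near. wt (b v))"
      using sum_image_le[of near wt b] near_far(1) by (simp add: b_def comp_def)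
    also have "\<dots> = int ((\<Sum>v\<in>near. f v) + (\<Sum>v\<in>near. g v))"
      by (simp add: b_def sum.distrib)
    also have "(\<Sum>v\<in>near. g v) = sum f far"
      unfolding g_def by (rule sum.group) (use near_far \<alpha> proj_le in \<open>auto simp: covers_def\<close>)
    also have "sum f near + sum f far = sum f (broadcasters T f)"
      using near_far by (metis sum.union_disjoint)
    also have "\<dots> = cost T f"
      unfolding cost_def using fin by (intro sum.mono_neutral_left) (auto simp: broadcasters_def)
    finally show ?thesis .
  qed
  ultimately show ?thesis by blast
qed

end

text \<open>If \<open>d\<close> were larger, the tight partition would have at least
  \<open>d + 1 - 2 * cost T f\<close> blocks, and the edges between them would form a split-set with
  more than \<open>m\<close> edges.\<close>

lemma diam_le_cost:
  assumes m: "1 \<le> m" "\<And>N. split_set T N \<Longrightarrow> card N \<le> m"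
    and f: "\<And>u. u \<in> V \<Longrightarrow> \<exists>v. hears T f u v"
  shows "d \<le> 2 * cost T f + m"
proof (rule ccontr)
  assume big: "\<not> ?thesis"
  let ?h = "\<lambda>j. int (height (nat j))"
  have h: "0 \<le> ?h j \<and> ?h j \<le> j \<and> ?h j \<le> int d - j" if "0 \<le> j" "j \<le> int d" for j
  proof -
    obtain k where "j = int k" using \<open>0 \<le> j\<close> zero_le_imp_eq_int by blast
    then show ?thesis using height_le[of k] that by simp
  qed
  obtain S0 where S0: "block_cover (int d) ?h S0" "sum wt S0 \<le> int (cost T f)"
    using block_cover_of_dominating[OF f] by blast
  have "2 * sum wt S0 < int d" using S0(2) big by linarith
  from tight_block_partition[OF S0(1) h this]
  obtain S where S: "block_cover (int d) ?h S" "sum wt S \<le> sum wt S0"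
    and tight: "\<And>b. b \<in> S \<Longrightarrow> debt b = 0 \<and> hi b - lo b = 2 * wt b"
    and disj: "\<And>b c. b \<in> S \<Longrightarrow> c \<in> S \<Longrightarrow> b \<noteq> c \<Longrightarrow> hi b < lo c \<or> hi c < lo b"
    by blast
  have good: "0 \<le> lo b" "lo b \<le> hi b" "hi b \<le> int d" "1 \<le> wt b" if "b \<in> S" for b
    using S(1) that by (auto simp: block_cover_def good_block_def)
  have finS: "finite S" using S(1) by (simp add: block_cover_def)
  have card_S: "int d + 1 = 2 * sum wt S + int (card S)"
    using card_tight_partition[OF S(1) _ conjunct2[OF tight] disj] by simp
  \<comment> \<open>All blocks but the last; the right end of each is the index of a cut
    edge.\<close>
  define E where "E = {b \<in> S. hi b < int d}"
  define I where "I = (\<lambda>b. nat (hi b)) ` E"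
  have same: "b = c" if "b \<in> S" "c \<in> S" "lo b \<le> hi c" "lo c \<le> hi b" for b c
    using disj[of b c] that by fastforce
  have "inj_on (\<lambda>b. nat (hi b)) E"
  proof (rule inj_onI)
    fix b c assume "b \<in> E" "c \<in> E" "nat (hi b) = nat (hi c)"
    then show "b = c" using same[of b c] good[of b] good[of c] by (auto simp: E_def)
  qed
  then have card_I: "card I = card E" unfolding I_def by (rule card_image)
  have "card (S - E) \<le> 1"
    unfolding card_le_Suc0_iff_eq[OF finite_Diff[OF finS], folded One_nat_def]
  proof (intro ballI)
    fix b c assume bc: "b \<in> S - E" "c \<in> S - E"
    then show "b = c" using same[of b c] good[of b] good[of c] by (auto simp: E_def)
  qed
  moreover have "card S = card E + card (S - E)"
    using card_Diff_subset[of E S] card_mono[of S E] finS by (auto simp: E_def)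
  ultimately have card_E: "m < card I" using card_S card_I S(2) S0(2) big by linarith
  \<comment> \<open>As all debts vanish, each branch satisfies the height bounds of a block exactly
    as a split-set requires.\<close>
  have cov: "\<exists>b\<in>S. lo b \<le> int j \<and> int j \<le> hi b \<and> lo b \<le> int j - int (height j) \<and> int j + int (height j) \<le> hi b"
    if "j \<le> d" for j
  proof -
    have "int j \<in> {0..int d}" using that by simp
    then obtain b where "b \<in> S" "lo b \<le> int j" "int j \<le> hi b"
      "lo b - 3 * debt b \<le> int j - ?h (int j)" "int j + ?h (int j) \<le> hi b + 3 * debt b"
      using S(1) unfolding block_cover_def by blast
    then show ?thesis using tight[of b] by (intro bexI[of _ b]) auto
  qed
  have I_sub: "I \<subseteq> {..<d}" using good(1,2) unfolding I_def E_def by fastforce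
  have "split_set T (cut I)"
  proof (rule split_set_cutI[OF I_sub])
    show "I \<noteq> {}" using card_E by auto
    fix j assume "j \<le> d"
    then obtain b where b: "b \<in> S" "lo b \<le> int j" "int j \<le> hi b" using cov by blast
    note gb = good[OF b(1)]
    obtain x y where xy: "lo b = int x" "hi b = int y" using gb by (metis order_trans zero_le_imp_eq_int)
    \<comment> \<open>The block covering \<open>x - 1\<close> differs from \<open>b\<close>, so it
      ends at \<open>x - 1\<close> and is not the last one.\<close>
    have "x = 0 \<or> x - 1 \<in> I"
    proof (cases "x = 0")
      case False
      then have "x - 1 \<le> d" using gb xy by simp
      then obtain c where c: "c \<in> S" "lo c \<le> int (x - 1)" "int (x - 1) \<le> hi c" using cov by blast
      have "hi c < int x" using same[of b c] c b(1) gb xy False by fastforce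
      then have "hi c = int (x - 1)" using c(3) False by linarith
      then have "c \<in> E" "nat (hi c) = x - 1" using c(1) gb xy False by (auto simp: E_def)
      then show ?thesis unfolding I_def by (metis imageI)
    qed simp
    moreover have "y = d \<or> y \<in> I"
      using b(1) gb xy by (force simp: I_def E_def)
    moreover have "I \<inter> {x..<y} = {}"
    proof (rule ccontr)
      assume "I \<inter> {x..<y} \<noteq> {}"
      then obtain c where c: "c \<in> S" "x \<le> nat (hi c)" "nat (hi c) < y" by (auto simp: I_def E_def)
      then show False using same[of b c] b(1) gb good[of c] xy by fastforce
    qed
    ultimately have "is_block I x y" using gb xy by (auto simp: is_block_def)
    moreover have "int (y - x) = 2 * wt b" using tight[OF b(1)] gb xy by auto
    then have "even (y - x)" by (metis dvd_triv_left even_of_nat)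
    moreover have "x < y" using tight[OF b(1)] gb xy by auto
    moreover have "\<forall>v\<in>slab x y. x + ht v \<le> proj v \<and> proj v + ht v \<le> y"
    proof
      fix v assume v: "v \<in> slab x y"
      obtain c where c: "c \<in> S" "lo c \<le> int (proj v)" "int (proj v) \<le> hi c"
        "lo c \<le> int (proj v) - int (height (proj v))" "int (proj v) + int (height (proj v)) \<le> hi c"
        using cov[OF proj_le] by blast
      have "b = c" using same[OF b(1) c(1)] c(2,3) v xy by (simp add: slab_def)
      then show "x + ht v \<le> proj v \<and> proj v + ht v \<le> y"
        using c(4,5) xy v ht_le_height[of v] by (simp add: slab_def)
    qed
    moreover have "x \<le> j" "j \<le> y" using b xy by simp_all
    ultimately show "\<exists>x y. is_block I x y \<and> x \<le> j \<and> j \<le> y \<and> even (y - x) \<and> x < y \<and>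
      (\<forall>v\<in>slab x y. x + ht v \<le> proj v \<and> proj v + ht v \<le> y)" by blast
  qed
  then have "card (cut I) \<le> m" by (rule m(2))
  with card_E show False using card_image[OF inj_on_cut[OF I_sub]] by simp
qed

text \<open>Every vertex may broadcast its eccentricity, which is positive as
  \<open>d \<ge> 1\<close>. Existence ensures that the minimum defining the broadcast number is
  attained.\<close>

lemma ex_dominating_broadcast:
  assumes "1 \<le> d" shows "\<exists>f. dominating_broadcast T f"
proof -
  let ?f = "\<lambda>v. if v \<in> V then ecc T v else undefined"
  have ne: "p 0 \<noteq> p d" using p_inj[of 0 d] assms by simp
  then have "card V \<noteq> 1"
    using p_verts[of 0] p_verts[of d] by (metis card_1_singletonE le_refl singletonD zero_le)
  then have "broadcast T ?f"
    using ecc_le_diam[OF fin] by (auto simp: broadcast_def)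
  moreover have "hears T ?f u u" if u: "u \<in> V" for u
  proof -
    have "ecc T u \<noteq> 0"
      using ne gdist_eq_0[OF conn u p_verts[of 0]] gdist_eq_0[OF conn u p_verts[of d]]
        gdist_le_ecc[OF fin p_verts[of 0], of u] gdist_le_ecc[OF fin p_verts[of d], of u] by force
    then show ?thesis using u by (simp add: hears_def broadcasters_def gdist_self)
  qed
  ultimately show ?thesis unfolding dominating_broadcast_def by blast
qed

lemma diam_le_broadcast_number:
  assumes "1 \<le> d" "1 \<le> m" "\<And>N. split_set T N \<Longrightarrow> card N \<le> m"
  shows "d \<le> 2 * broadcast_number T + m"
proof -
  have "\<exists>n f. dominating_broadcast T f \<and> cost T f = n"
    using ex_dominating_broadcast[OF assms(1)] by blast
  then have "\<exists>f. dominating_broadcast T f \<and> cost T f = broadcast_number T"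
    unfolding broadcast_number_def by (rule LeastI_ex)
  then show ?thesis using diam_le_cost[OF assms(2,3)] by (metis dominating_broadcast_def)
qed

end

theorem theorem2p5:
  fixes T :: "'a graph" and M :: "'a set set"
  assumes "tree T" and "\<not> radial T" and "maximum_split_set T M"
  shows "int (i_bn T) \<le> int (broadcast_number T) + \<lceil>(real (card M) + 1) / 3\<rceil>"
proof -
  let ?m = "card M"
  have max: "\<And>N. split_set T N \<Longrightarrow> card N \<le> ?m" and "split_set T M"
    using assms(3) by (auto simp: maximum_split_set_def)
  then obtain P where P: "diametrical_path T P" "M \<subseteq> walk_edges P" "1 \<le> ?m"
    "\<And>H. H \<in> components (delete_edges T M) \<Longrightarrow> even (walk_length (subpath_in P H)) \<and>
      0 < walk_length (subpath_in P H) \<and> diametrical_path H (subpath_in P H)"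
    unfolding split_set_def by blast
  interpret tree_diametrical_path T P using assms(1) P(1) by unfold_locales
  obtain I where I: "I \<subseteq> {..<d}" "card I = ?m"
    "\<And>x y. is_block I x y \<Longrightarrow> even (y - x) \<and> x < y"
    "\<And>x y v. is_block I x y \<Longrightarrow> v \<in> slab x y \<Longrightarrow> x + ht v \<le> proj v \<and> proj v + ht v \<le> y"
    using split_set_cutD[OF P(2,4)] by blast
  obtain s t where st: "s 0 = 0" "\<And>r. s (Suc r) = Suc (t r)" "t (card I) = d"
    "\<And>r. r \<le> card I \<Longrightarrow> is_block I (s r) (t r)"
    using consecutive_blocks[OF I(1)] by blast
  define q where "q = ?m div 3"
  have "2 * i_bn T + ?m \<le> d + 2 * (q + 1)"
    unfolding q_def
  proof (rule i_bn_le_blocks)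
    show "even (t r - s r) \<and> s r < t r" if "r \<le> ?m" for r
      using I(3) st(4) that unfolding I(2) by blast
    show "s r + ht v \<le> proj v \<and> proj v + ht v \<le> t r" if "r \<le> ?m" "v \<in> slab (s r) (t r)" for r v
      using I(4) st(4) that unfolding I(2) by blast
  qed (use P(3) st(1-3) I(2) in auto)
  moreover have "1 \<le> d" using I(1,2) P(3) by (cases d) auto
  then have "d \<le> 2 * broadcast_number T + ?m"
    using diam_le_broadcast_number[OF _ P(3) max] by simp
  ultimately have "i_bn T \<le> broadcast_number T + (q + 1)" by presburger
  \<comment> \<open>The integer \<open>q\<close> is strictly below \<open>(card M + 1) / 3\<close>,
    so the ceiling is at least \<open>q + 1\<close>.\<close>
  moreover have "int (q + 1) \<le> \<lceil>(real ?m + 1) / 3\<rceil>"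
  proof -
    have "3 * q \<le> ?m" by (simp add: q_def)
    then have "3 * real q \<le> real ?m" by (metis of_nat_le_iff of_nat_mult of_nat_numeral)
    then show ?thesis unfolding le_ceiling_iff by simp
  qed
  ultimately show ?thesis by linarith
qed

end
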